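(* Consider the SSS scheme with equiprobable rectangular $M_I\times M_Q$ QAM over Rayleigh fading ($|h|^2$ has density $e^{-x}$, $x\ge0$). Let $P_{\rm pk},Q_{\rm pk}>0$ and suppose that the transmit powers are $P_0=P_1=\min\{P_{\rm pk},Q_{\rm pk}/|g|^2\}$, where $|g|^2$ is exponentially distributed with unit mean. Let $\mathrm{SEP}$ be the symbol error probability of the optimal (maximum a posteriori) detector averaged over $h$ and $g$, and let $\mathrm{SEP}(P_{\rm pk})$ be the one averaged over $h$ when the powers are fixed at $P_0=P_1=P_{\rm pk}$. With $b_1=Q_{\rm pk}/P_{\rm pk}$, $$\begin{aligned}\mathrm{SEP}\le(1-e^{-b_1})\,\mathrm{SEP}(P_{\rm pk})+\Big(2-\frac1{M_I}-\frac1{M_Q}\Big)\sum_{k=0}^1\Pr\{\hat{\mathcal H}_k\}\Bigg\{&\Pr\{\mathcal H_0|\hat{\mathcal H}_k\}\Big[e^{-b_1}-2\sqrt{\gamma_0\pi}\,e^{\gamma_0}Q\big(\sqrt{2(b_1+\gamma_0)}\big)\Big]\\ +&\Pr\{\mathcal H_1|\hat{\mathcal H}_k\}\sum_{l=1}^p\lambda_l\Big[e^{-b_1}-2\sqrt{\gamma_{1,l}\pi}\,e^{\gamma_{1,l}}Q\big(\sqrt{2(b_1+\gamma_{1,l})}\big)\Big]\Bigg\},\end{aligned}$$ where $$\gamma_0=\frac{3b_1P_{\rm pk}}{2(M_I^2+M_Q^2-2)\sigma_n^2},\qquad \gamma_{1,l}=\frac{3b_1P_{\rm pk}}{2(M_I^2+M_Q^2-2)(\sigma_l^2+\sigma_n^2)},\qquad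 Q(x)=\int_x^\infty\frac1{\sqrt{2\pi}}e^{-t^2/2}\,dt.$$ Moreover, equality holds for PAM, i.e. when $M_I=M$ and $M_Q=1$.
   Context: Setting (cognitive radio with imperfect sensing). The true channel state is $\mathcal H_0$ (primary user idle) or $\mathcal H_1$ (primary user active), with given prior probabilities. The sensing decision is $\hat{\mathcal H}_0$ (idle) or $\hat{\mathcal H}_1$ (busy), with $P_{\rm d}=\Pr\{\hat{\mathcal H}_1|\mathcal H_1\}$ and $P_{\rm f}=\Pr\{\hat{\mathcal H}_1|\mathcal H_0\}$. The quantities $\Pr\{\hat{\mathcal H}_k\}$ and $\Pr\{\mathcal H_j|\hat{\mathcal H}_k\}$ follow by total probability and Bayes' rule; assume $\Pr\{\hat{\mathcal H}_k\}>0$ for both $k$. In the sensing-based spectrum sharing (SSS) scheme the secondary user transmits with power $P_k$ under decision $\hat{\mathcal H}_k$, $k=0,1$. $P_{\rm pk}$ is a peak transmit power limit, $Q_{\rm pk}$ a peak interference limit, and $g$ the fading coefficient between secondary transmitter and primary receiver (known to the secondary transmitter). Constellation. $M_I,M_Q\ge1$ are integers with $M=M_IM_Q\ge 2$. Under $\hat{\mathcal H}_k$ the transmitted symbol is uniform on the points $s_{n,q}=s_n+js_q$ with $$s_n=(2n+1-M_I)\tfrac{d_{min,k}}{2}\ (0\le n\le M_I-1),\qquad s_q=(2q+1-M_Q)\tfrac{d_{min,k}}{2}\ (0\le q\le M_Q-1),$$ $$d_{min,k}=\sqrt{\tfrac{12P_k}{M_I^2+M_Q^2-2}}.$$ Channel.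 The received signal is $y=hs+n$ under $\mathcal H_0$ and $y=hs+n+w$ under $\mathcal H_1$. The noise $n$ has density $\frac{1}{2\pi\sigma_n^2}e^{-|n|^2/(2\sigma_n^2)}$ on $\mathbb C$ ($\sigma_n^2>0$). The primary interference $w$ has Gaussian mixture density $\sum_{l=1}^p\frac{\lambda_l}{2\pi\sigma_l^2}e^{-|w|^2/(2\sigma_l^2)}$, with $\sigma_l^2>0$, $\lambda_l\ge0$, $\sum_l\lambda_l=1$. The variables $n$ and $w$ are independent of each other. Given the sensing decision and the true state, they are also independent of the transmitted symbol. The fading coefficients $h$ and $g$ are independent of each other and of the channel state, sensing decision, noise and interference. The constellation index $(n,q)$ of the transmitted symbol is independent of $h$ and $g$. Detector. Knowing $\hat{\mathcal H}_k$, $h$, the constellation in use (i.e. the power $P_k$) and $y$, the receiver outputs a constellation point maximizing $\Pr\{\mathcal H_0|\hat{\mathcal H}_k\}f(y|s,h,\hat{\mathcal H}_k,\mathcal H_0)+\Pr\{\mathcal H_1|\hat{\mathcal H}_k\}f(y|s,h,\hat{\mathcal H}_k,\mathcal H_1)$, where $f(y|s,h,\hat{\mathcal H}_k,\mathcal H_j)$ is the conditional density of $y$. The symbol error probability is the probability that the output differs from the transmitted symbol, averaged over symbol, sensing decision and true state. *)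

theory Defs
  imports "HOL-Probability.Probability"
begin

(* The true channel state H and the sensing decision Hhat are boolean random variables:
   True stands for "primary user active" (resp. "sensed busy"), i.e. for the index 1 of
   the hypotheses; False stands for the index 0. *)

definition Qfun :: "real \<Rightarrow> real" where
  "Qfun x = set_lebesgue_integral lborel {x..} (\<lambda>t. 1 / sqrt (2 * pi) * exp (- t\<^sup>2 / 2))"

definition cgauss_density :: "real \<Rightarrow> complex \<Rightarrow> real" where
  "cgauss_density v z = 1 / (2 * pi * v) * exp (- (cmod z)\<^sup>2 / (2 * v))"

definition gauss_mixture_density :: "nat \<Rightarrow> (nat \<Rightarrow> real) \<Rightarrow> (nat \<Rightarrow> real) \<Rightarrow> complex \<Rightarrow> real" where
  "gauss_mixture_density p lam \<sigma> z = (\<Sum>l=1..p. lam l * cgauss_density ((\<sigma> l)\<^sup>2) z)"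

definition d_min :: "nat \<Rightarrow> nat \<Rightarrow> real \<Rightarrow> real" where
  "d_min MI MQ P = sqrt (12 * P / ((real MI)\<^sup>2 + (real MQ)\<^sup>2 - 2))"

definition qam_point :: "nat \<Rightarrow> nat \<Rightarrow> real \<Rightarrow> nat \<times> nat \<Rightarrow> complex" where
  "qam_point MI MQ P = (\<lambda>(i, q).
     Complex ((2 * real i + 1 - real MI) * (d_min MI MQ P / 2))
             ((2 * real q + 1 - real MQ) * (d_min MI MQ P / 2)))"

definition constellation :: "nat \<Rightarrow> nat \<Rightarrow> real \<Rightarrow> complex set" where
  "constellation MI MQ P = qam_point MI MQ P ` ({..<MI} \<times> {..<MQ})"

(* HOL-Probability's indep_vars needs variables with a common range type, so the mutual
   independence of h, g, (H, Hhat), the constellation index, the noise and the primary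
   interference is stated as: their joint law is the product of their laws.
   The joint law of (H, Hhat), hence the priors, P_d and P_f, is otherwise arbitrary.
   The interference w enters the received signal only when H is True. *)
locale sensing_channel = prob_space M
  for M :: "'w measure" +
  fixes H Hhat :: "'w \<Rightarrow> bool"
    and idx :: "'w \<Rightarrow> nat \<times> nat"
    and h g noise w :: "'w \<Rightarrow> complex"
    and MI MQ p :: nat
    and lam \<sigma> :: "nat \<Rightarrow> real"
    and \<sigma>n :: real
  assumes size: "MI \<ge> 1" "MQ \<ge> 1" "MI * MQ \<ge> 2"
    and noise_var_pos: "\<sigma>n\<^sup>2 > 0"
    and comp_var_pos: "\<And>l. l \<in> {1..p} \<Longrightarrow> (\<sigma> l)\<^sup>2 > 0"
    and weight_nonneg: "\<And>l. l \<in> {1..p} \<Longrightarrow> lam l \<ge> 0"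
    and weight_sum: "(\<Sum>l=1..p. lam l) = 1"
    and measurable_state: "random_variable (count_space UNIV) H"
      "random_variable (count_space UNIV) Hhat"
    and measurable_idx: "random_variable (count_space UNIV) idx"
    and measurable_fading: "random_variable borel h" "random_variable borel g"
    and decision_pos: "\<And>k. \<P>(\<omega> in M. Hhat \<omega> = k) > 0"
    and idx_uniform:
      "distr M (count_space UNIV) idx = measure_pmf (pmf_of_set ({..<MI} \<times> {..<MQ}))"
    and noise_law: "distributed M lborel noise (cgauss_density (\<sigma>n\<^sup>2))"
    and interference_law: "distributed M lborel w (gauss_mixture_density p lam \<sigma>)"
    and independence:
      "distr M (borel \<Otimes>\<^sub>M borel \<Otimes>\<^sub>M count_space UNIV \<Otimes>\<^sub>M count_space UNIV \<Otimes>\<^sub>M borel \<Otimes>\<^sub>M borel)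
         (\<lambda>\<omega>. (h \<omega>, g \<omega>, (H \<omega>, Hhat \<omega>), idx \<omega>, noise \<omega>, w \<omega>))
       = distr M borel h \<Otimes>\<^sub>M distr M borel g
         \<Otimes>\<^sub>M distr M (count_space UNIV) (\<lambda>\<omega>. (H \<omega>, Hhat \<omega>))
         \<Otimes>\<^sub>M distr M (count_space UNIV) idx
         \<Otimes>\<^sub>M distr M borel noise \<Otimes>\<^sub>M distr M borel w"

(* Conditional density of the received signal y given the symbol s, the fading h and the
   true state j, where fn and fw are the densities of the noise and of the interference.
   The sensing decision does not affect it.  Under j = True it is the density of
   h * s + noise + w, i.e. the translated convolution of fn and fw. *)
definition rx_density ::
  "(complex \<Rightarrow> real) \<Rightarrow> (complex \<Rightarrow> real) \<Rightarrow> complex \<Rightarrow> complex \<Rightarrow> bool \<Rightarrow> complex \<Rightarrow> real" where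
  "rx_density fn fw s h j y =
     (if j then (\<integral>v. fn (y - h * s - v) * fw v \<partial>lborel) else fn (y - h * s))"

definition map_metric ::
  "'w measure \<Rightarrow> ('w \<Rightarrow> bool) \<Rightarrow> ('w \<Rightarrow> bool) \<Rightarrow> (complex \<Rightarrow> real) \<Rightarrow> (complex \<Rightarrow> real)
    \<Rightarrow> bool \<Rightarrow> complex \<Rightarrow> complex \<Rightarrow> complex \<Rightarrow> real" where
  "map_metric M H Hhat fn fw k h y s =
     \<P>(\<omega> in M. \<not> H \<omega> \<bar> Hhat \<omega> = k) * rx_density fn fw s h False y
   + \<P>(\<omega> in M. H \<omega> \<bar> Hhat \<omega> = k) * rx_density fn fw s h True y"

(* A detector maps the sensing decision, the transmit power in use, the fading h and the
   received signal y to a constellation point.  Ties may be broken in any measurable way. *)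
definition is_MAP_detector ::
  "'w measure \<Rightarrow> ('w \<Rightarrow> bool) \<Rightarrow> ('w \<Rightarrow> bool) \<Rightarrow> (complex \<Rightarrow> real) \<Rightarrow> (complex \<Rightarrow> real)
    \<Rightarrow> nat \<Rightarrow> nat \<Rightarrow> (bool \<Rightarrow> real \<Rightarrow> complex \<Rightarrow> complex \<Rightarrow> complex) \<Rightarrow> bool" where
  "is_MAP_detector M H Hhat fn fw MI MQ \<delta> \<longleftrightarrow>
     (\<forall>k. (\<lambda>(P, h, y). \<delta> k P h y) \<in> borel_measurable borel) \<and>
     (\<forall>k P h y. P > 0 \<longrightarrow>
        is_arg_max (map_metric M H Hhat fn fw k h y) (\<lambda>s. s \<in> constellation MI MQ P) (\<delta> k P h y))"

(* pw k z is the transmit power under the sensing decision k when g = z. *)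
definition symbol_error_prob ::
  "'w measure \<Rightarrow> ('w \<Rightarrow> bool) \<Rightarrow> ('w \<Rightarrow> bool) \<Rightarrow> ('w \<Rightarrow> nat \<times> nat)
    \<Rightarrow> ('w \<Rightarrow> complex) \<Rightarrow> ('w \<Rightarrow> complex) \<Rightarrow> ('w \<Rightarrow> complex) \<Rightarrow> ('w \<Rightarrow> complex)
    \<Rightarrow> nat \<Rightarrow> nat \<Rightarrow> (bool \<Rightarrow> complex \<Rightarrow> real)
    \<Rightarrow> (bool \<Rightarrow> real \<Rightarrow> complex \<Rightarrow> complex \<Rightarrow> complex) \<Rightarrow> real" where
  "symbol_error_prob M H Hhat idx h g noise w MI MQ pw \<delta> =
     \<P>(\<omega> in M.
        let P = pw (Hhat \<omega>) (g \<omega>);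
            s = qam_point MI MQ P (idx \<omega>);
            y = h \<omega> * s + noise \<omega> + (if H \<omega> then w \<omega> else 0)
        in \<delta> (Hhat \<omega>) P (h \<omega>) y \<noteq> s)"

(* For z = 0 there is no interference at the primary receiver and only the peak power
   limit is active; HOL's convention x / 0 = 0 would give power 0 instead. *)
definition peak_limited_power :: "real \<Rightarrow> real \<Rightarrow> complex \<Rightarrow> real" where
  "peak_limited_power Ppk Qpk z = (if z = 0 then Ppk else min Ppk (Qpk / (cmod z)\<^sup>2))"

end

theory Submission
  imports Defs
begin

text \<open>
  Given the sensing decision, the MAP metric is a mixture of centred circular Gaussian densities in
  \<open>y - h s\<close>, because the convolution of two such densities adds their variances. It is therefore
  strictly decreasing in \<open>cmod (y - h s)\<close>, and the MAP detector is a minimum distance detector.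
  Dividing the noise by \<open>h\<close> leaves it circular Gaussian, so for each mixture component the real
  and imaginary parts are decided independently. Averaging over the symbols, the error probability is
  \<open>2 (2 - 1/M\<^sub>I - 1/M\<^sub>Q) Q(a) - 4 (1 - 1/M\<^sub>I) (1 - 1/M\<^sub>Q) Q(a)\<^sup>2\<close>; the inequality drops the second
  term, which vanishes for PAM. The Rayleigh average of the first term is a closed form in the power,
  and splitting the average over \<open>g\<close> at \<open>(cmod g)\<^sup>2 = b1\<close>, where the power limit that is active changes,
  gives the two parts of the bound.
\<close>

subsection \<open>Lebesgue measure on the complex plane\<close>

text \<open>Both decisions use the same power, and the metric decreases with distance for all
  posterior weights, so the sensing decision affects neither the signal nor the set of nearest
  points. Only the true state counts: the averages use the prior of \<open>H\<close>, into which the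
  sum over decisions in the bound folds by total probability. Detectors are fixed only up to ties. A
  tie for nearest that involves the sent point puts the rotated noise on a cell boundary, a null
  set, so every MAP detector has the same error probability. What is computed is the probability of
  a correct decision, because that one factors over the two axes. With power P, component variance v
  and D = MI^2 + MQ^2 - 2, the tail argument is sqrt(c |h|^2) with c = 3 P / (D v), and its Rayleigh
  mean is (1 - sqrt(c / (c + 2))) / 2. Where the interference limit binds, P = Qpk / y with y =
  |g|^2, so c = 2 \<gamma> / y and the root becomes sqrt(\<gamma> / (y + \<gamma>)). This is the
  origin of the 2 in the denominators of \<gamma>0 and \<gamma>1, and of \<open>b1 * Ppk\<close>,
  which is \<open>Qpk\<close>, in their numerators. Integrating against exp(-y) over y > b1 gives
  the brackets of the bound.\<close>

lemma lborel_complex_eq_distr: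
  "(lborel :: complex measure) = distr (lborel \<Otimes>\<^sub>M lborel) borel (\<lambda>(x, y). Complex x y)"
proof (rule lborel_eqI)
  have m[measurable]: "(\<lambda>(x, y). Complex x y) \<in> borel_measurable (borel \<Otimes>\<^sub>M borel)"
    unfolding borel_prod by (intro borel_measurable_continuous_onI) (auto simp: split_beta' Complex_eq intro!: continuous_intros)
  fix l u :: complex
  assume le: "\<And>b. b \<in> Basis \<Longrightarrow> l \<bullet> b \<le> u \<bullet> b"
  \<comment> \<open>Over the basis formed by 1 and the imaginary unit, an open box is a product of
    two open intervals.\<close>
  have "emeasure (distr (lborel \<Otimes>\<^sub>M lborel) borel (\<lambda>(x, y). Complex x y)) (box l u)
      = emeasure (lborel \<Otimes>\<^sub>M lborel) ({Re l<..<Re u} \<times> {Im l<..<Im u})"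
    by (subst emeasure_distr)
       (auto simp: space_pair_measure box_def Basis_complex_def inner_complex_def intro!: arg_cong[where f="emeasure _"])
  also have "\<dots> = ennreal ((Re u - Re l) * (Im u - Im l))"
    using le[of 1] le[of \<i>]
    by (subst lborel.emeasure_pair_measure_Times) (auto simp: Basis_complex_def inner_complex_def ennreal_mult)
  also have "(Re u - Re l) * (Im u - Im l) = (\<Prod>b\<in>Basis. (u - l) \<bullet> b)"
    by (simp add: Basis_complex_def inner_complex_def)
  finally show "emeasure (distr (lborel \<Otimes>\<^sub>M lborel) borel (\<lambda>(x, y). Complex x y)) (box l u)
      = (\<Prod>b\<in>Basis. (u - l) \<bullet> b)" .
qed simp

lemma measurable_Complex[measurable (raw)]:
  assumes [measurable]: "f \<in> borel_measurable M" "g \<in> borel_measurable M"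
  shows "(\<lambda>x. Complex (f x) (g x)) \<in> borel_measurable M"
  unfolding Complex_eq by measurable

lemma nn_integral_lborel_complex:
  assumes [measurable]: "f \<in> borel_measurable borel"
  shows "(\<integral>\<^sup>+z. f z \<partial>lborel) = (\<integral>\<^sup>+x. \<integral>\<^sup>+y. f (Complex x y) \<partial>lborel \<partial>lborel)"
  by (subst lborel_complex_eq_distr)
     (simp add: nn_integral_distr lborel.nn_integral_fst[symmetric] split_beta')

text \<open>Multiplication by \<open>h\<close> is a linear map of the plane with determinant |h|^2.
  Factoring it into maps that change one coordinate at a time leaves only affine substitutions on
  the line and Fubini.\<close>

lemma nn_integral_lborel_complex_mult:
  assumes [measurable]: "f \<in> borel_measurable borel" and h: "h \<noteq> 0"
  shows "(\<integral>\<^sup>+z. f z \<partial>lborel) = (cmod h)\<^sup>2 * (\<integral>\<^sup>+z. f (h * z) \<partial>lborel)"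
proof -
  define a b where "a = Re h" and "b = Im h"
  have h': "(cmod h)\<^sup>2 = a\<^sup>2 + b\<^sup>2" "a\<^sup>2 + b\<^sup>2 > 0"
    using h by (auto simp: a_def b_def cmod_power2 complex_eq_iff sum_power2_gt_zero_iff)
  have 1: "(\<integral>\<^sup>+z. f (h * z) \<partial>lborel) = (\<integral>\<^sup>+y. \<integral>\<^sup>+x. f (Complex (a * x - b * y) (b * x + a * y)) \<partial>lborel \<partial>lborel)"
    (is "_ = ?R")
  proof -
    have "(\<integral>\<^sup>+z. f (h * z) \<partial>lborel) = (\<integral>\<^sup>+x. \<integral>\<^sup>+y. f (h * Complex x y) \<partial>lborel \<partial>lborel)"
      by (rule nn_integral_lborel_complex) measurable
    also have "\<dots> = (\<integral>\<^sup>+y. \<integral>\<^sup>+x. f (h * Complex x y) \<partial>lborel \<partial>lborel)"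
      by (rule lborel_pair.Fubini') measurable
    also have "\<dots> = ?R"
      by (intro nn_integral_cong arg_cong[where f=f]) (simp add: complex_eq_iff a_def b_def)
    finally show ?thesis .
  qed
  have 2: "(\<integral>\<^sup>+z. f z \<partial>lborel) = (\<integral>\<^sup>+y. \<integral>\<^sup>+x. f (Complex x y) \<partial>lborel \<partial>lborel)"
    by (subst nn_integral_lborel_complex, measurable, rule lborel_pair.Fubini') measurable
  show ?thesis
  proof (cases "a = 0")
    case True
    \<comment> \<open>Here \<open>h\<close> is \<open>b\<close> times the imaginary unit: it swaps
      the axes and scales them by \<open>b\<close> and \<open>- b\<close>, so two scalings followed
      by a renaming of the bound variables suffice.\<close>
    have b: "b \<noteq> 0" using h' True by auto
    have "(\<integral>\<^sup>+z. f z \<partial>lborel) = (\<integral>\<^sup>+x. \<integral>\<^sup>+y. f (Complex x y) \<partial>lborel \<partial>lborel)"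
      by (rule nn_integral_lborel_complex) measurable
    also have "\<dots> = (\<integral>\<^sup>+x. ennreal \<bar>b\<bar> * (\<integral>\<^sup>+y. f (Complex x (0 + b * y)) \<partial>lborel) \<partial>lborel)"
      by (intro nn_integral_cong nn_integral_real_affine b) measurable
    also have "\<dots> = ennreal \<bar>b\<bar> * (\<integral>\<^sup>+x. (\<integral>\<^sup>+y. f (Complex x (0 + b * y)) \<partial>lborel) \<partial>lborel)"
      by (rule nn_integral_cmult) measurable
    also have "\<dots> = ennreal \<bar>b\<bar> * (ennreal \<bar>-b\<bar> * (\<integral>\<^sup>+x. (\<integral>\<^sup>+y. f (Complex (0 + (- b) * x) (0 + b * y)) \<partial>lborel) \<partial>lborel))"
      by (subst nn_integral_real_affine[where c="-b" and t=0]) (use b in auto)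
    also have "\<dots> = (cmod h)\<^sup>2 * (\<integral>\<^sup>+z. f (h * z) \<partial>lborel)"
      unfolding 1 h' using True
      by (simp add: mult.assoc[symmetric] ennreal_mult[symmetric] power2_eq_square)
    finally show ?thesis .
  next
    case a: False
    \<comment> \<open>Multiplication by \<open>h\<close> is \<open>x \<mapsto> a x - b y\<close> for fixed \<open>y\<close>, then
      \<open>y \<mapsto> (b/a) x + ((a\<^sup>2 + b\<^sup>2)/a) y\<close> for fixed \<open>x\<close>.\<close>
    let ?c = "(a\<^sup>2 + b\<^sup>2) / a"
    have c: "?c \<noteq> 0" using a h' by auto
    have "(\<integral>\<^sup>+x. f (Complex (a * x - b * y) (b * x + a * y)) \<partial>lborel)
        = ennreal \<bar>1 / a\<bar> * (\<integral>\<^sup>+x. f (Complex x (b / a * x + ?c * y)) \<partial>lborel)" for y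
    proof -
      have "(\<integral>\<^sup>+x. f (Complex (a * x - b * y) (b * x + a * y)) \<partial>lborel) =
        ennreal \<bar>1/a\<bar> * (\<integral>\<^sup>+x. f (Complex (a * (b * y / a + 1 / a * x) - b * y) (b * (b * y / a + 1 / a * x) + a * y)) \<partial>lborel)"
        by (rule nn_integral_real_affine) (use a in auto)
      also have "\<dots> = ennreal \<bar>1 / a\<bar> * (\<integral>\<^sup>+x. f (Complex x (b / a * x + ?c * y)) \<partial>lborel)"
        using a by (intro arg_cong2[where f="(*)"] nn_integral_cong arg_cong[where f=f])
          (simp_all add: field_simps power2_eq_square)
      finally show ?thesis .
    qed
    then have "?R = ennreal \<bar>1 / a\<bar> * (\<integral>\<^sup>+y. \<integral>\<^sup>+x. f (Complex x (b / a * x + ?c * y)) \<partial>lborel \<partial>lborel)"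
      by (simp add: nn_integral_cmult)
    also have "(\<integral>\<^sup>+y. \<integral>\<^sup>+x. f (Complex x (b / a * x + ?c * y)) \<partial>lborel \<partial>lborel)
      = (\<integral>\<^sup>+x. \<integral>\<^sup>+y. f (Complex x (b / a * x + ?c * y)) \<partial>lborel \<partial>lborel)"
      by (rule lborel_pair.Fubini'[symmetric]) measurable
    finally have R: "?R = ennreal \<bar>1 / a\<bar> * (\<integral>\<^sup>+x. \<integral>\<^sup>+y. f (Complex x (b / a * x + ?c * y)) \<partial>lborel \<partial>lborel)" .
    have "(\<integral>\<^sup>+z. f z \<partial>lborel) = (\<integral>\<^sup>+x. \<integral>\<^sup>+y. f (Complex x y) \<partial>lborel \<partial>lborel)"
      by (rule nn_integral_lborel_complex) measurable
    also have "\<dots> = (\<integral>\<^sup>+x. ennreal \<bar>?c\<bar> * (\<integral>\<^sup>+y. f (Complex x (b / a * x + ?c * y)) \<partial>lborel) \<partial>lborel)"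
      by (intro nn_integral_cong nn_integral_real_affine c) measurable
    also have "\<dots> = ennreal \<bar>?c\<bar> * (\<integral>\<^sup>+x. (\<integral>\<^sup>+y. f (Complex x (b / a * x + ?c * y)) \<partial>lborel) \<partial>lborel)"
      by (rule nn_integral_cmult) measurable
    also have "\<bar>?c\<bar> = (cmod h)\<^sup>2 * \<bar>1 / a\<bar>"
      unfolding h' using h' by (simp add: abs_mult)
    finally show ?thesis
      unfolding 1 R by (simp only: ennreal_mult[OF zero_le_power2 abs_ge_zero] mult.assoc)
  qed
qed

lemma nn_integral_lborel_translate:
  fixes f :: "'a::euclidean_space \<Rightarrow> ennreal"
  assumes [measurable]: "f \<in> borel_measurable borel"
  shows "(\<integral>\<^sup>+z. f (z - c) \<partial>lborel) = (\<integral>\<^sup>+z. f z \<partial>lborel)"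
  by (subst lborel_distr_plus[of "-c", symmetric]) (simp add: nn_integral_distr)

subsection \<open>Circular Gaussian densities\<close>

lemma cgauss_density_nonneg: "v > 0 \<Longrightarrow> cgauss_density v z \<ge> 0"
  by (simp add: cgauss_density_def)

lemma borel_measurable_cgauss_density[measurable]: "cgauss_density v \<in> borel_measurable borel"
  unfolding cgauss_density_def[abs_def] by measurable

lemma cgauss_density_Complex:
  assumes "v > 0"
  shows "cgauss_density v (Complex x y) = normal_density 0 (sqrt v) x * normal_density 0 (sqrt v) y"
  using assms
  by (simp add: cgauss_density_def normal_density_def cmod_power2 add_divide_distrib diff_divide_distrib
      flip: exp_add)

text \<open>In Cartesian coordinates a circular Gaussian is a product of two centred normal
  densities of equal variance, so the convolution rule on the line applies to each
  coordinate.\<close>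

lemma nn_integral_cgauss_conv:
  assumes "a > 0" "b > 0"
  shows "(\<integral>\<^sup>+v. ennreal (cgauss_density a (z - v) * cgauss_density b v) \<partial>lborel) = cgauss_density (a + b) z"
proof -
  obtain x y where z: "z = Complex x y" by (cases z)
  let ?n = "\<lambda>v. normal_density 0 (sqrt v)"
  have diff: "Complex x y - Complex s t = Complex (x - s) (y - t)" for s t by (simp add: complex_eq_iff)
  have 1: "(\<integral>\<^sup>+s. ennreal (?n a (x - s) * ?n b s) \<partial>lborel) = ?n (a + b) x" for x
    using fun_cong[OF conv_normal_density_zero_mean[of "sqrt a" "sqrt b"], of x] assms by simp
  have "(\<integral>\<^sup>+v. ennreal (cgauss_density a (z - v) * cgauss_density b v) \<partial>lborel)
     = (\<integral>\<^sup>+s. \<integral>\<^sup>+t. ennreal (?n a (x - s) * ?n b s) * ennreal (?n a (y - t) * ?n b t) \<partial>lborel \<partial>lborel)"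
    using assms
    by (subst nn_integral_lborel_complex)
       (auto intro!: nn_integral_cong simp: z diff cgauss_density_Complex ennreal_mult[symmetric] mult_ac)
  also have "\<dots> = ennreal (?n (a + b) x) * ennreal (?n (a + b) y)"
    by (simp add: nn_integral_cmult nn_integral_multc 1)
  also have "\<dots> = cgauss_density (a + b) z"
    using assms by (simp add: z cgauss_density_Complex ennreal_mult)
  finally show ?thesis .
qed

text \<open>\<open>rx_density\<close> is a Bochner integral, which is 0 by convention for a
  non-integrable function; the value is therefore carried together with integrability.\<close>

lemma has_bochner_integral_cgauss_conv:
  assumes "a > 0" "b > 0"
  shows "has_bochner_integral lborel (\<lambda>v. cgauss_density a (z - v) * cgauss_density b v) (cgauss_density (a + b) z)"
  using assms by (intro has_bochner_integral_nn_integral nn_integral_cgauss_conv)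
    (auto intro!: AE_I2 mult_nonneg_nonneg cgauss_density_nonneg)

lemma rx_density_gauss_mixture:
  assumes "v > 0" "\<And>l. l \<in> {1..p} \<Longrightarrow> (\<sigma> l)\<^sup>2 > 0"
  shows "rx_density (cgauss_density v) (gauss_mixture_density p lam \<sigma>) s h True y
    = (\<Sum>l=1..p. lam l * cgauss_density (v + (\<sigma> l)\<^sup>2) (y - h * s))"
proof -
  have "has_bochner_integral lborel
     (\<lambda>u. \<Sum>l=1..p. lam l * (cgauss_density v (y - h * s - u) * cgauss_density ((\<sigma> l)\<^sup>2) u))
     (\<Sum>l=1..p. lam l * cgauss_density (v + (\<sigma> l)\<^sup>2) (y - h * s))"
    using assms by (intro has_bochner_integral_sum has_bochner_integral_mult_right has_bochner_integral_cgauss_conv) auto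
  then show ?thesis
    by (simp add: rx_density_def gauss_mixture_density_def sum_distrib_left mult_ac has_bochner_integral_integral_eq)
qed

lemma cgauss_density_strict_antimono:
  assumes "v > 0" "cmod x < cmod y"
  shows "cgauss_density v y < cgauss_density v x"
  using assms by (simp add: cgauss_density_def divide_strict_right_mono power_strict_mono mult_strict_left_mono)

subsection \<open>The Gaussian tail function\<close>

lemma Qfun_eq_integral: "Qfun x = (\<integral>t. indicator {x..} t * std_normal_density t \<partial>lborel)"
  by (simp add: Qfun_def set_lebesgue_integral_def std_normal_density_def)

lemma set_integrable_std_normal_density:
  "A \<in> sets borel \<Longrightarrow> integrable lborel (\<lambda>t. indicator A t * std_normal_density t)"
  using integrable_mult_indicator[of A lborel std_normal_density] by simp

lemma Qfun_nonneg: "0 \<le> Qfun x"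
  unfolding Qfun_eq_integral by (intro integral_nonneg_AE AE_I2) auto

text \<open>The two closed half lines cover the line and overlap in one null point.\<close>

lemma Qfun_compl: "Qfun x = 1 - (\<integral>t. indicator {..x} t * std_normal_density t \<partial>lborel)"
proof -
  have "Qfun x + (\<integral>t. indicator {..x} t * std_normal_density t \<partial>lborel)
      = (\<integral>t. indicator {x..} t * std_normal_density t + indicator {..x} t * std_normal_density t \<partial>lborel)"
    unfolding Qfun_eq_integral by (rule Bochner_Integration.integral_add[symmetric]) (auto intro: set_integrable_std_normal_density)
  also have "\<dots> = (\<integral>t. std_normal_density t \<partial>lborel)"
    using AE_lborel_singleton[of x]
    by (intro integral_cong_AE) (auto elim!: eventually_mono simp: indicator_def)
  finally show ?thesis by simp
qed

lemma Qfun_minus: "Qfun (- x) = 1 - Qfun x"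
proof -
  have "(\<integral>t. indicator {..-x} t * std_normal_density t \<partial>lborel)
      = (\<integral>t. indicator {x..} t * std_normal_density t \<partial>lborel)"
    by (subst lborel_integral_real_affine[where c="-1" and t=0])
       (auto intro!: Bochner_Integration.integral_cong simp: indicator_def std_normal_density_def)
  then show ?thesis
    using Qfun_compl[of "-x"] by (simp add: Qfun_eq_integral)
qed

lemma Qfun_le_1: "Qfun x \<le> 1"
  using Qfun_minus[of x] Qfun_nonneg[of "-x"] by simp

lemma Qfun_0: "Qfun 0 = 1 / 2"
  using Qfun_minus[of 0] by simp

lemma Qfun_antimono: "x \<le> y \<Longrightarrow> Qfun y \<le> Qfun x"
  unfolding Qfun_eq_integral
  by (intro integral_mono set_integrable_std_normal_density) (auto simp: indicator_def)

lemma borel_measurable_Qfun[measurable]: "Qfun \<in> borel_measurable borel"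
proof -
  have "mono (\<lambda>x. - Qfun x)" by (auto intro!: monoI Qfun_antimono)
  then have "(\<lambda>x. - (- Qfun x)) \<in> borel_measurable borel"
    by (intro borel_measurable_uminus borel_measurable_mono)
  then show ?thesis by simp
qed

lemma Qfun_tendsto_0: "(Qfun \<longlongrightarrow> 0) at_top"
proof -
  have "((\<lambda>x. \<integral>t. indicator {..x} t *\<^sub>R std_normal_density t \<partial>lborel)
     \<longlongrightarrow> (\<integral>t. std_normal_density t \<partial>lborel)) at_top"
    by (rule tendsto_integral_at_top) auto
  then have "((\<lambda>x. 1 - (\<integral>t. indicator {..x} t *\<^sub>R std_normal_density t \<partial>lborel)) \<longlongrightarrow> 1 - 1) at_top"
    by (intro tendsto_diff) auto
  then show ?thesis
    by (simp add: Qfun_compl[abs_def])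
qed

text \<open>On a compact window around \<open>x\<close> the tail is a constant minus a proper
  integral, to which the fundamental theorem of calculus applies; \<open>x\<close> is interior, so
  the derivative within the window is a full derivative.\<close>

lemma Qfun_has_real_derivative: "(Qfun has_real_derivative - std_normal_density x) (at x)"
proof -
  define a b where "a = x - 1" and "b = x + 1"
  have cont: "continuous_on {a..b} std_normal_density"
    unfolding std_normal_density_def by (intro continuous_intros) auto
  have "((\<lambda>u. integral {a..u} std_normal_density) has_real_derivative std_normal_density x) (at x within {a..b})"
    by (rule integral_has_real_derivative[OF cont]) (auto simp: a_def b_def)
  then have "((\<lambda>u. Qfun a - integral {a..u} std_normal_density) has_real_derivative 0 - std_normal_density x) (at x within {a..b})"
    by (intro DERIV_diff DERIV_const)
  moreover have "Qfun a - integral {a..u} std_normal_density = Qfun u" if "u \<in> {a..b}" for u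
  proof -
    have i: "set_integrable lborel {a..u} std_normal_density"
      using set_integrable_std_normal_density[of "{a..u}"] by (simp add: set_integrable_def)
    have "Qfun a = (\<integral>t. indicator {a..u} t * std_normal_density t + indicator {u..} t * std_normal_density t \<partial>lborel)"
      unfolding Qfun_eq_integral using AE_lborel_singleton[of u] that
      by (intro integral_cong_AE) (auto elim!: eventually_mono simp: indicator_def)
    also have "\<dots> = (\<integral>t. indicator {a..u} t * std_normal_density t \<partial>lborel) + Qfun u"
      unfolding Qfun_eq_integral by (rule Bochner_Integration.integral_add) (auto intro: set_integrable_std_normal_density)
    also have "(\<integral>t. indicator {a..u} t * std_normal_density t \<partial>lborel) = integral {a..u} std_normal_density"
      using set_borel_integral_eq_integral(2)[OF i] by (simp add: set_lebesgue_integral_def)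
    finally show ?thesis by simp
  qed
  moreover have "at x within {a..b} = at x"
    by (rule at_within_interior) (simp add: a_def b_def)
  ultimately have D: "((\<lambda>u. Qfun a - integral {a..u} std_normal_density) has_real_derivative 0 - std_normal_density x) (at x)"
    and eq: "\<And>u. u \<in> {a<..<b} \<Longrightarrow> Qfun a - integral {a..u} std_normal_density = Qfun u"
    by simp_all
  show ?thesis
    using has_field_derivative_transform_within_open[OF D, of "{a<..<b}" Qfun] eq by (simp add: a_def b_def)
qed

text \<open>Scaling by \<open>s\<close> standardises the law. The half line is open because it
  arises as part of the complement of a closed decision cell.\<close>

lemma measure_normal_greaterThan:
  assumes s: "s > 0"
  shows "measure (density lborel (normal_density 0 s)) {a<..} = Qfun (a / s)"
proof -
  have "emeasure (density lborel (normal_density 0 s)) {a<..}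
     = (\<integral>\<^sup>+t. ennreal (normal_density 0 s t) * indicator {a<..} t \<partial>lborel)"
    by (rule emeasure_density) auto
  also have "\<dots> = \<bar>s\<bar> * (\<integral>\<^sup>+u. ennreal (normal_density 0 s (0 + s * u)) * indicator {a<..} (0 + s * u) \<partial>lborel)"
    by (rule nn_integral_real_affine) (use s in auto)
  also have "\<dots> = (\<integral>\<^sup>+u. ennreal (s * normal_density 0 s (s * u)) * indicator {a<..} (s * u) \<partial>lborel)"
    using s by (simp add: nn_integral_cmult[symmetric] ennreal_mult mult.assoc)
  also have "\<dots> = (\<integral>\<^sup>+u. ennreal (indicator {a/s..} u * std_normal_density u) \<partial>lborel)"
    using AE_lborel_singleton[of "a / s"]
  proof (intro nn_integral_cong_AE, elim eventually_mono)
    fix u assume "u \<noteq> a / s"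
    moreover have "s * normal_density 0 s (s * u) = std_normal_density u"
      using s by (simp add: normal_density_def real_sqrt_mult power_mult_distrib)
    ultimately show "ennreal (s * normal_density 0 s (s * u)) * indicator {a<..} (s * u)
        = ennreal (indicator {a/s..} u * std_normal_density u)"
      using s by (auto simp: indicator_def field_simps)
  qed
  also have "\<dots> = ennreal (Qfun (a / s))"
    unfolding Qfun_eq_integral
    by (intro nn_integral_eq_integral set_integrable_std_normal_density AE_I2) auto
  finally show ?thesis by (simp add: measure_def Qfun_nonneg)
qed

lemma measure_normal_lessThan:
  assumes s: "s > 0"
  shows "measure (density lborel (normal_density 0 s)) {..<-a} = Qfun (a / s)"
proof -
  have "emeasure (density lborel (normal_density 0 s)) {..<-a}
     = (\<integral>\<^sup>+t. ennreal (normal_density 0 s t) * indicator {..<-a} t \<partial>lborel)"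
    by (rule emeasure_density) auto
  also have "\<dots> = \<bar>-1::real\<bar> * (\<integral>\<^sup>+t. ennreal (normal_density 0 s (0 + (-1) * t)) * indicator {..<-a} (0 + (-1) * t) \<partial>lborel)"
    by (rule nn_integral_real_affine) auto
  also have "\<dots> = (\<integral>\<^sup>+t. ennreal (normal_density 0 s t) * indicator {a<..} t \<partial>lborel)"
    by (auto intro!: nn_integral_cong simp: normal_density_def indicator_def)
  also have "\<dots> = emeasure (density lborel (normal_density 0 s)) {a<..}"
    by (rule emeasure_density[symmetric]) auto
  finally show ?thesis using measure_normal_greaterThan[OF s] by (simp add: measure_def)
qed

subsection \<open>Decision regions of rectangular QAM\<close>

text \<open>With \<open>a\<close> half the spacing, these are the offsets from amplitude
  \<open>i\<close> of \<open>m\<close> for which no neighbour is strictly closer. An end amplitude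
  lacks a neighbour, so its cell is unbounded on that side; for \<open>m = 1\<close> the cell is the
  whole line.\<close>

definition decision_cell :: "nat \<Rightarrow> real \<Rightarrow> nat \<Rightarrow> real set" where
  "decision_cell m a i = {t. (0 < i \<longrightarrow> - a \<le> t) \<and> (Suc i < m \<longrightarrow> t \<le> a)}"

lemma decision_cell_borel[measurable]: "decision_cell m a i \<in> sets borel"
  unfolding decision_cell_def by measurable

text \<open>The complement consists of at most two tails, disjoint because \<open>a \<ge> 0\<close>
  and of equal mass by symmetry.\<close>

lemma measure_decision_cell:
  assumes "s > 0" "a \<ge> 0"
  shows "measure (density lborel (normal_density 0 s)) (decision_cell m a i)
    = 1 - of_bool (0 < i) * Qfun (a / s) - of_bool (Suc i < m) * Qfun (a / s)"
proof -
  interpret N: prob_space "density lborel (normal_density 0 s)"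
    by (rule prob_space_normal_density[OF assms(1)])
  let ?N = "measure (density lborel (normal_density 0 s))"
  let ?l = "if 0 < i then {..<-a} else {}" and ?r = "if Suc i < m then {a<..} else {}"
  have "?N (decision_cell m a i) = ?N (UNIV - (?l \<union> ?r))"
    by (intro arg_cong[where f="?N"]) (auto simp: decision_cell_def)
  also have "\<dots> = 1 - ?N (?l \<union> ?r)"
    using N.prob_compl[of "?l \<union> ?r"] by simp
  also have "?N (?l \<union> ?r) = ?N ?l + ?N ?r"
    using assms(2) by (intro N.finite_measure_Union) auto
  also have "?N ?l = of_bool (0 < i) * Qfun (a / s)"
    using measure_normal_lessThan[OF assms(1), of a] by simp
  also have "?N ?r = of_bool (Suc i < m) * Qfun (a / s)"
    using measure_normal_greaterThan[OF assms(1), of a] by simp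
  finally show ?thesis by simp
qed

text \<open>Of the \<open>m\<close> amplitudes, \<open>m - 1\<close> have a left and
  \<open>m - 1\<close> a right neighbour, so \<open>2 * (m - 1)\<close> tails are lost in
  all.\<close>

lemma sum_measure_decision_cell:
  assumes "s > 0" "a \<ge> 0" "m \<ge> 1"
  shows "(\<Sum>i<m. measure (density lborel (normal_density 0 s)) (decision_cell m a i))
    = real m * (1 - 2 * (1 - 1 / real m) * Qfun (a / s))"
proof -
  have 1: "(\<Sum>i<m. of_bool (0 < i) :: real) = real m - 1"
  proof -
    have "{..<m} \<inter> {i. 0 < i} = {1..<m}" by auto
    then show ?thesis using assms(3) by (simp add: of_nat_diff)
  qed
  have 2: "(\<Sum>i<m. of_bool (Suc i < m) :: real) = real m - 1"
  proof -
    have "{..<m} \<inter> {i. Suc i < m} = {..<m - 1}" by auto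
    then show ?thesis using assms(3) by (simp add: of_nat_diff)
  qed
  have "(\<Sum>i<m. measure (density lborel (normal_density 0 s)) (decision_cell m a i))
    = real m - (\<Sum>i<m. of_bool (0 < i)) * Qfun (a / s) - (\<Sum>i<m. of_bool (Suc i < m)) * Qfun (a / s)"
    unfolding sum_distrib_right measure_decision_cell[OF assms(1,2)] by (simp add: sum_subtractf)
  also have "\<dots> = real m * (1 - 2 * (1 - 1 / real m) * Qfun (a / s))"
    unfolding 1 2 using assms(3) by (simp add: field_simps)
  finally show ?thesis .
qed

section \<open>Amplitudes on one axis and nearest points of the grid\<close>

definition pam_point :: "nat \<Rightarrow> real \<Rightarrow> nat \<Rightarrow> real" where
  "pam_point m d i = (2 * real i + 1 - real m) * (d / 2)"

lemma pam_point_diff: "pam_point m d i - pam_point m d i' = (real i - real i') * d"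
  by (simp add: pam_point_def field_simps)

text \<open>The other amplitude lies at distance at least \<open>d\<close> on a side where the cell
  of \<open>i\<close> is bounded by \<open>d / 2\<close>. Excluding the boundary makes the
  comparison strict.\<close>

lemma pam_point_closest:
  assumes d: "d > 0" and i: "i < m" "i' < m" "i \<noteq> i'"
    and u: "u \<in> decision_cell m (d / 2) i" "u \<noteq> d / 2" "u \<noteq> - d / 2"
  shows "\<bar>u\<bar> < \<bar>pam_point m d i + u - pam_point m d i'\<bar>"
proof -
  have e: "pam_point m d i + u - pam_point m d i' = u + (real i - real i') * d"
    using pam_point_diff[of m d i i'] by simp
  consider "i < i'" | "i' < i" using i by linarith
  then show ?thesis
  proof cases
    case 1
    then have "u < d / 2" using u i by (auto simp: decision_cell_def)
    moreover have "(real i - real i') * d \<le> (-1) * d" using 1 d by (intro mult_right_mono) auto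
    ultimately show ?thesis unfolding e using d by linarith
  next
    case 2
    then have "u > - d / 2" using u by (auto simp: decision_cell_def)
    moreover have "(real i - real i') * d \<ge> 1 * d" using 2 d by (intro mult_right_mono) auto
    ultimately show ?thesis unfolding e using d by linarith
  qed
qed

text \<open>The witness is the neighbour across the violated boundary; it exists because only sides
  with a neighbour are bounded.\<close>

lemma pam_point_not_closest:
  assumes d: "d > 0" and i: "i < m" and u: "u \<notin> decision_cell m (d / 2) i"
  shows "\<exists>i'<m. \<bar>pam_point m d i + u - pam_point m d i'\<bar> < \<bar>u\<bar>"
proof (cases "0 < i \<and> u < - d / 2")
  case True
  then have "pam_point m d i + u - pam_point m d (i - 1) = u + d"
    using pam_point_diff[of m d i "i - 1"] by (simp add: of_nat_diff)
  then show ?thesis using True d i by (intro exI[of _ "i - 1"]) auto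
next
  case False
  then have "Suc i < m" "u > d / 2" using u by (auto simp: decision_cell_def)
  moreover have "pam_point m d i + u - pam_point m d (Suc i) = u - d"
    using pam_point_diff[of m d i "Suc i"] by simp
  ultimately show ?thesis using d by (intro exI[of _ "Suc i"]) auto
qed

lemma qam_point_eq: "qam_point MI MQ P (i, q) = Complex (pam_point MI (d_min MI MQ P) i) (pam_point MQ (d_min MI MQ P) q)"
  by (simp add: qam_point_def pam_point_def)

text \<open>This is the denominator in \<open>d_min\<close>; it would vanish for a single point,
  which \<open>MI * MQ \<ge> 2\<close> rules out.\<close>

lemma qam_size_pos:
  assumes "MI \<ge> 1" "MQ \<ge> 1" "MI * MQ \<ge> 2"
  shows "(real MI)\<^sup>2 + (real MQ)\<^sup>2 - 2 > 0"
proof -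
  have "(MI = 1 \<and> MQ \<ge> 2) \<or> MI \<ge> 2" using assms by (cases "MI = 1") auto
  then have "real MI \<ge> 1 \<and> real MQ \<ge> 1 \<and> (real MI \<ge> 2 \<or> real MQ \<ge> 2)" using assms by auto
  then have "(real MI)\<^sup>2 \<ge> 1\<^sup>2" "(real MQ)\<^sup>2 \<ge> 1\<^sup>2" "(real MI)\<^sup>2 \<ge> 2\<^sup>2 \<or> (real MQ)\<^sup>2 \<ge> 2\<^sup>2"
    using power_mono[of 1 "real MI" 2] power_mono[of 1 "real MQ" 2] power_mono[of 2 "real MI" 2] power_mono[of 2 "real MQ" 2]
    by auto
  then show ?thesis by auto
qed

lemma d_min_pos:
  assumes "MI \<ge> 1" "MQ \<ge> 1" "MI * MQ \<ge> 2" "P > 0"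
  shows "d_min MI MQ P > 0"
  using qam_size_pos[OF assms(1-3)] assms(4) by (simp add: d_min_def)

lemma abs_less_square_iff: "\<bar>x\<bar> < \<bar>y\<bar> \<longleftrightarrow> x\<^sup>2 < (y :: 'a :: linordered_idom)\<^sup>2"
  using abs_le_square_iff[of y x] by (simp flip: not_le)

text \<open>Squared distance is a sum over the two coordinates. If the offset lies in both cells, a
  minimiser with a wrong index would be strictly worse in that coordinate and no better in the
  other. If it lies outside a cell, changing that one coordinate to a neighbour beats the sent
  point. Here \<open>x\<close> is any minimiser, so no tie-breaking rule enters.\<close>

lemma nearest_qam_point_iff:
  assumes size: "MI \<ge> 1" "MQ \<ge> 1" "MI * MQ \<ge> 2" "P > 0"
    and iq: "i < MI" "q < MQ"
    and u: "\<bar>Re u\<bar> \<noteq> d_min MI MQ P / 2" "\<bar>Im u\<bar> \<noteq> d_min MI MQ P / 2"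
    and x: "x \<in> constellation MI MQ P"
    and min: "\<And>x'. x' \<in> constellation MI MQ P \<Longrightarrow>
      cmod (qam_point MI MQ P (i, q) + u - x) \<le> cmod (qam_point MI MQ P (i, q) + u - x')"
  shows "x = qam_point MI MQ P (i, q) \<longleftrightarrow>
    Re u \<in> decision_cell MI (d_min MI MQ P / 2) i \<and> Im u \<in> decision_cell MQ (d_min MI MQ P / 2) q"
proof -
  define d where "d = d_min MI MQ P"
  let ?s = "qam_point MI MQ P (i, q)"
  have d: "d > 0" using d_min_pos[OF size] by (simp add: d_def)
  obtain i' q' where x': "x = qam_point MI MQ P (i', q')" "i' < MI" "q' < MQ"
    using x by (auto simp: constellation_def)
  have le: "(Re (?s + u - x))\<^sup>2 + (Im (?s + u - x))\<^sup>2
      \<le> (Re (?s + u - qam_point MI MQ P (a, b)))\<^sup>2 + (Im (?s + u - qam_point MI MQ P (a, b)))\<^sup>2"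
    if "a < MI" "b < MQ" for a b
    using min[of "qam_point MI MQ P (a, b)"] that
    by (auto simp: constellation_def cmod_def)
  have le': "(pam_point MI d i + Re u - pam_point MI d i')\<^sup>2 + (pam_point MQ d q + Im u - pam_point MQ d q')\<^sup>2
      \<le> (pam_point MI d i + Re u - pam_point MI d a)\<^sup>2 + (pam_point MQ d q + Im u - pam_point MQ d b)\<^sup>2"
    if "a < MI" "b < MQ" for a b
    using le[OF that] by (simp add: x' qam_point_eq d_def)
  have inner: "Re u \<in> decision_cell MI (d / 2) i \<and> Im u \<in> decision_cell MQ (d / 2) q \<Longrightarrow> i = i' \<and> q = q'"
  proof (rule ccontr)
    assume c: "Re u \<in> decision_cell MI (d / 2) i \<and> Im u \<in> decision_cell MQ (d / 2) q"
      and neq: "\<not> (i = i' \<and> q = q')"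
    have 1: "(Re u)\<^sup>2 < (pam_point MI d i + Re u - pam_point MI d i')\<^sup>2" if "i \<noteq> i'"
      unfolding abs_less_square_iff[symmetric]
      by (rule pam_point_closest[OF d iq(1) x'(2) that]) (use c u(1) d in \<open>auto simp: abs_if simp flip: d_def\<close>)
    have 2: "(Im u)\<^sup>2 < (pam_point MQ d q + Im u - pam_point MQ d q')\<^sup>2" if "q \<noteq> q'"
      unfolding abs_less_square_iff[symmetric]
      by (rule pam_point_closest[OF d iq(2) x'(3) that]) (use c u(2) d in \<open>auto simp: abs_if simp flip: d_def\<close>)
    have 3: "(Re u)\<^sup>2 \<le> (pam_point MI d i + Re u - pam_point MI d i')\<^sup>2"
      using 1 by (cases "i = i'") (simp_all add: less_imp_le)
    have 4: "(Im u)\<^sup>2 \<le> (pam_point MQ d q + Im u - pam_point MQ d q')\<^sup>2"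
      using 2 by (cases "q = q'") (simp_all add: less_imp_le)
    have 5: "(pam_point MI d i + Re u - pam_point MI d i')\<^sup>2 + (pam_point MQ d q + Im u - pam_point MQ d q')\<^sup>2
      \<le> (Re u)\<^sup>2 + (Im u)\<^sup>2"
      using le'[OF iq] by simp
    from neq consider "i \<noteq> i'" | "q \<noteq> q'" by blast
    then show False
    proof cases
      case one: 1
      show False using add_less_le_mono[OF 1[OF one] 4] 5 by simp
    next
      case two: 2
      show False using add_le_less_mono[OF 3 2[OF two]] 5 by simp
    qed
  qed
  have outer: "Re u \<in> decision_cell MI (d / 2) i \<and> Im u \<in> decision_cell MQ (d / 2) q" if eq: "x = ?s"
  proof (rule ccontr)
    have le2: "(Re u)\<^sup>2 + (Im u)\<^sup>2
      \<le> (pam_point MI d i + Re u - pam_point MI d a)\<^sup>2 + (pam_point MQ d q + Im u - pam_point MQ d b)\<^sup>2"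
      if "a < MI" "b < MQ" for a b
      using le[OF that] eq by (simp add: qam_point_eq d_def)
    assume "\<not> (Re u \<in> decision_cell MI (d / 2) i \<and> Im u \<in> decision_cell MQ (d / 2) q)"
    then consider "Re u \<notin> decision_cell MI (d / 2) i" | "Im u \<notin> decision_cell MQ (d / 2) q" by blast
    then show False
    proof cases
      case 1
      then obtain a where "a < MI" "\<bar>pam_point MI d i + Re u - pam_point MI d a\<bar> < \<bar>Re u\<bar>"
        using pam_point_not_closest[OF d iq(1)] by blast
      moreover from this have "(pam_point MI d i + Re u - pam_point MI d a)\<^sup>2 < (Re u)\<^sup>2"
        by (simp only: abs_less_square_iff)
      ultimately show False using le2[of a q] iq by simp
    next
      case 2
      then obtain b where "b < MQ" "\<bar>pam_point MQ d q + Im u - pam_point MQ d b\<bar> < \<bar>Im u\<bar>"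
        using pam_point_not_closest[OF d iq(2)] by blast
      moreover from this have "(pam_point MQ d q + Im u - pam_point MQ d b)\<^sup>2 < (Im u)\<^sup>2"
        by (simp only: abs_less_square_iff)
      ultimately show False using le2[of i b] iq by simp
    qed
  qed
  show ?thesis unfolding d_def[symmetric]
  proof
    show "x = ?s \<Longrightarrow> Re u \<in> decision_cell MI (d / 2) i \<and> Im u \<in> decision_cell MQ (d / 2) q"
      by (rule outer)
    assume "Re u \<in> decision_cell MI (d / 2) i \<and> Im u \<in> decision_cell MQ (d / 2) q"
    from inner[OF this] show "x = ?s" by (simp only: x'(1))
  qed
qed

subsection \<open>Exponential averages of the tail function\<close>

text \<open>Since the derivative is nonnegative, the limits of the antiderivative at both ends give
  integrability along with the value.\<close>

lemma has_bochner_integral_FTC_at_top: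
  fixes f F :: "real \<Rightarrow> real"
  assumes F: "\<And>x. a < x \<Longrightarrow> (F has_real_derivative f x) (at x)"
    and f: "\<And>x. a < x \<Longrightarrow> isCont f x" "\<And>x. a < x \<Longrightarrow> 0 \<le> f x"
    and lim: "(F \<longlongrightarrow> A) (at_right a)" "(F \<longlongrightarrow> B) at_top"
  shows "has_bochner_integral lborel (\<lambda>x. indicator {a<..} x * f x) (B - A)"
proof -
  have *: "((F \<circ> real_of_ereal) \<longlongrightarrow> A) (at_right (ereal a))" "((F \<circ> real_of_ereal) \<longlongrightarrow> B) (at_left \<infinity>)"
    using lim by (simp_all add: ereal_tendsto_simps)
  have "set_integrable lborel (einterval (ereal a) \<infinity>) f"
    by (rule interval_integral_FTC_nonneg(1)[OF _ _ _ _ *]) (use F f in auto)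
  moreover have "(LBINT x=ereal a..\<infinity>. f x) = B - A"
    by (rule interval_integral_FTC_nonneg(2)[OF _ _ _ _ *]) (use F f in auto)
  moreover have "einterval (ereal a) \<infinity> = {a<..}" by (auto simp: einterval_def)
  ultimately show ?thesis
    by (simp add: has_bochner_integral_iff set_integrable_def interval_lebesgue_integral_def set_lebesgue_integral_def)
qed

text \<open>The shift \<open>a\<close> is 0 in the Rayleigh average over \<open>h\<close> and
  \<open>- \<gamma>\<close> in the tail average over \<open>g\<close>.\<close>

lemma Qfun_sqrt_has_real_derivative:
  assumes "c > 0" "x > a"
  shows "((\<lambda>x. Qfun (sqrt (c * (x - a)))) has_real_derivative
    - (sqrt c / (2 * sqrt (2 * pi) * sqrt (x - a)) * exp (- c * (x - a) / 2))) (at x)"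
proof -
  have "((\<lambda>x. sqrt (c * (x - a))) has_real_derivative inverse (sqrt (c * (x - a))) / 2 * c) (at x)"
    by (rule DERIV_real_sqrt[THEN DERIV_chain2]) (use assms in \<open>auto intro!: derivative_eq_intros\<close>)
  from DERIV_chain2[OF Qfun_has_real_derivative this]
  have "((\<lambda>x. Qfun (sqrt (c * (x - a)))) has_real_derivative
    - std_normal_density (sqrt (c * (x - a))) * (inverse (sqrt (c * (x - a))) / 2 * c)) (at x)" .
  moreover have "inverse (sqrt (c * (x - a))) / 2 * c = sqrt c / (2 * sqrt (x - a))"
    using assms by (simp add: real_sqrt_mult divide_simps)
  moreover have "std_normal_density (sqrt (c * (x - a))) = exp (- c * (x - a) / 2) / sqrt (2 * pi)"
    using assms by (simp add: std_normal_density_def)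
  ultimately show ?thesis
    by (elim DERIV_cong) (simp add: mult_ac)
qed

lemma isCont_Qfun: "isCont Qfun x"
  using Qfun_has_real_derivative by (rule DERIV_isCont)

lemma Qfun_sqrt_tendsto_0:
  assumes "c > 0"
  shows "((\<lambda>x. Qfun (sqrt (c * (x - a)))) \<longlongrightarrow> 0) at_top"
  by (rule filterlim_compose[OF Qfun_tendsto_0], rule filterlim_compose[OF sqrt_at_top],
      rule filterlim_tendsto_pos_mult_at_top[OF tendsto_const assms])
     (auto intro: filterlim_tendsto_add_at_top[of "\<lambda>_. -a" "-a" at_top "\<lambda>x. x", simplified] filterlim_ident)

lemma exp_minus_tendsto_0: "((\<lambda>x::real. exp (- x)) \<longlongrightarrow> 0) at_top"
  by (rule filterlim_compose[OF exp_at_bot filterlim_uminus_at_bot_at_top])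

text \<open>The antiderivative comes from integration by parts. Differentiating the tail in
  \<open>- exp (- x) * Qfun (sqrt (c * x))\<close> leaves a multiple of
  \<open>exp (- (c + 2) * x / 2) / sqrt x\<close>, which is again the derivative of a tail, now with
  \<open>c + 2\<close> in place of \<open>c\<close>; the factor \<open>sqrt (c / (c + 2))\<close>
  matches the coefficients.\<close>

lemma has_bochner_integral_exp_Qfun_sqrt:
  assumes c: "c > 0"
  shows "has_bochner_integral lborel (\<lambda>x. exponential_density 1 x * Qfun (sqrt (c * x)))
     ((1 - sqrt (c / (c + 2))) / 2)"
proof -
  define F where "F x = - exp (- x) * Qfun (sqrt (c * (x - 0)))
     + sqrt (c / (c + 2)) * Qfun (sqrt ((c + 2) * (x - 0)))" for x
  have "has_bochner_integral lborel (\<lambda>x. indicator {0<..} x * (exp (- x) * Qfun (sqrt (c * x))))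
     (0 - (- 1 / 2 + sqrt (c / (c + 2)) / 2))"
  proof (rule has_bochner_integral_FTC_at_top)
    fix x :: real assume x: "0 < x"
    have e: "exp (- x) * exp (- c * x / 2) = exp (- (c + 2) * x / 2)"
      unfolding exp_add[symmetric] by (simp add: field_simps)
    have s: "sqrt (c / (c + 2)) * sqrt (c + 2) = sqrt c"
      using c by (simp add: real_sqrt_divide)
    show "(F has_real_derivative exp (- x) * Qfun (sqrt (c * x))) (at x)"
    proof -
      have D: "(F has_real_derivative
         (exp (- x) * Qfun (sqrt (c * (x - 0)))
           + - (sqrt c / (2 * sqrt (2 * pi) * sqrt (x - 0)) * exp (- c * (x - 0) / 2)) * - exp (- x))
         + sqrt (c / (c + 2)) * - (sqrt (c + 2) / (2 * sqrt (2 * pi) * sqrt (x - 0)) * exp (- (c + 2) * (x - 0) / 2))) (at x)"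
        unfolding F_def using c x
        by (intro DERIV_add DERIV_cmult DERIV_mult Qfun_sqrt_has_real_derivative)
           (auto intro!: derivative_eq_intros)
      have r1: "- (sqrt c / K * exp (- c * x / 2)) * - exp (- x)
         = sqrt c / K * exp (- (c + 2) * x / 2)" for K
        by (simp only: e[symmetric]) simp
      have r2: "sqrt (c / (c + 2)) * - (sqrt (c + 2) / K * E) = - (sqrt c / K * E)" for K E
        by (simp only: s[symmetric]) simp
      show ?thesis by (rule DERIV_cong[OF D], unfold diff_zero r1 r2) (simp only: add_uminus_conv_diff add_diff_cancel_right')
    qed
    show "isCont (\<lambda>x. exp (- x) * Qfun (sqrt (c * x))) x"
      by (intro continuous_intros isCont_o2[OF _ isCont_Qfun])
    show "0 \<le> exp (- x) * Qfun (sqrt (c * x))" by (simp add: Qfun_nonneg)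
  next
    \<comment> \<open>Each summand of \<open>F\<close> has an unbounded derivative at 0, but
      \<open>F\<close> is continuous there; the value uses \<open>Qfun 0 = 1 / 2\<close>.\<close>
    have "isCont F 0"
      unfolding F_def by (intro continuous_intros isCont_o2[OF _ isCont_Qfun])
    then have "(F \<longlongrightarrow> F 0) (at_right 0)"
      by (auto simp: isCont_def intro: filterlim_mono[OF _ order_refl at_le])
    then show "(F \<longlongrightarrow> - 1 / 2 + sqrt (c / (c + 2)) / 2) (at_right 0)"
      by (simp add: F_def Qfun_0)
    have "(F \<longlongrightarrow> - 0 * 0 + sqrt (c / (c + 2)) * 0) at_top"
      unfolding F_def using c by (intro tendsto_intros Qfun_sqrt_tendsto_0 exp_minus_tendsto_0) auto
    then show "(F \<longlongrightarrow> 0) at_top" by simp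
  qed
  moreover have "AE x in lborel. indicator {0<..} x * (exp (- x) * Qfun (sqrt (c * x)))
     = exponential_density 1 x * Qfun (sqrt (c * x))"
    using AE_lborel_singleton[of "0::real"]
    by eventually_elim (auto simp: exponential_density_def indicator_def)
  ultimately have "has_bochner_integral lborel (\<lambda>x. exponential_density 1 x * Qfun (sqrt (c * x)))
     (0 - (- 1 / 2 + sqrt (c / (c + 2)) / 2))"
    by (subst (asm) has_bochner_integral_cong_AE) auto
  then show ?thesis by (simp add: diff_divide_distrib)
qed

text \<open>Writing \<open>exp (- x)\<close> as \<open>exp \<gamma> * exp (- (x + \<gamma>))\<close>
  makes the square-root part a multiple of
  \<open>exp (- (x + \<gamma>)) / sqrt (x + \<gamma>)\<close>, hence of the derivative of
  \<open>Qfun (sqrt (2 * (x + \<gamma>)))\<close>. The factor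
  \<open>2 * sqrt (\<gamma> * pi) * exp \<gamma>\<close> normalises it.\<close>

lemma has_bochner_integral_exp_tail:
  assumes g: "\<gamma> > 0" and b: "b \<ge> 0"
  shows "has_bochner_integral lborel (\<lambda>x. indicator {b<..} x * (exp (- x) * (1 - sqrt (\<gamma> / (x + \<gamma>)))))
    (exp (- b) - 2 * sqrt (\<gamma> * pi) * exp \<gamma> * Qfun (sqrt (2 * (b + \<gamma>))))"
proof -
  define F where "F x = - exp (- x) + 2 * sqrt (\<gamma> * pi) * exp \<gamma> * Qfun (sqrt (2 * (x - (- \<gamma>))))" for x
  have "has_bochner_integral lborel (\<lambda>x. indicator {b<..} x * (exp (- x) * (1 - sqrt (\<gamma> / (x + \<gamma>)))))
    (0 - F b)"
  proof (rule has_bochner_integral_FTC_at_top)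
    fix x :: real assume x: "b < x"
    have "(F has_real_derivative
       exp (- x) + 2 * sqrt (\<gamma> * pi) * exp \<gamma>
        * - (sqrt 2 / (2 * sqrt (2 * pi) * sqrt (x - (- \<gamma>))) * exp (- 2 * (x - (- \<gamma>)) / 2))) (at x)"
      unfolding F_def using g b x
      by (intro DERIV_add DERIV_cmult Qfun_sqrt_has_real_derivative) (auto intro!: derivative_eq_intros)
    moreover have "exp \<gamma> * exp (- 2 * (x - (- \<gamma>)) / 2) = exp (- x)"
      unfolding exp_add[symmetric] by (simp add: field_simps)
    then have "2 * sqrt (\<gamma> * pi) * exp \<gamma>
        * - (sqrt 2 / (2 * sqrt (2 * pi) * sqrt (x - (- \<gamma>))) * exp (- 2 * (x - (- \<gamma>)) / 2))
      = - exp (- x) * sqrt (\<gamma> / (x + \<gamma>))"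
      by (simp add: real_sqrt_mult real_sqrt_divide)
    ultimately show "(F has_real_derivative exp (- x) * (1 - sqrt (\<gamma> / (x + \<gamma>)))) (at x)"
      by (elim DERIV_cong) (simp add: algebra_simps)
    show "isCont (\<lambda>x. exp (- x) * (1 - sqrt (\<gamma> / (x + \<gamma>)))) x"
      using x b g by (intro continuous_intros) auto
    show "0 \<le> exp (- x) * (1 - sqrt (\<gamma> / (x + \<gamma>)))"
      using x b g by (simp add: real_sqrt_le_1_iff)
  next
    have "isCont F b"
      unfolding F_def by (intro continuous_intros isCont_o2[OF _ isCont_Qfun])
    then show "(F \<longlongrightarrow> F b) (at_right b)"
      by (auto simp: isCont_def intro: filterlim_mono[OF _ order_refl at_le])
    have "(F \<longlongrightarrow> - 0 + 2 * sqrt (\<gamma> * pi) * exp \<gamma> * 0) at_top"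
      unfolding F_def by (intro tendsto_intros Qfun_sqrt_tendsto_0 exp_minus_tendsto_0) auto
    then show "(F \<longlongrightarrow> 0) at_top" by simp
  qed
  then show ?thesis by (simp add: F_def)
qed

subsection \<open>Correct decisions in Gaussian noise\<close>

text \<open>The excluded set is a union of lines. With \<open>a\<close> half the minimum distance it
  contains all cell boundaries, so a tie for nearest that involves the sent point has probability
  zero.\<close>

lemma AE_lborel_complex_Re_Im_neq:
  "AE z in lborel. \<bar>Re z\<bar> \<noteq> a \<and> \<bar>Im z\<bar> \<noteq> a"
proof -
  have *: "AE x in lborel. \<bar>x :: real\<bar> \<noteq> a"
    using AE_lborel_singleton[of a] AE_lborel_singleton[of "-a"] by eventually_elim auto
  have "emeasure lborel {z. \<not> (\<bar>Re z\<bar> \<noteq> a \<and> \<bar>Im z\<bar> \<noteq> a)}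
      = (\<integral>\<^sup>+z. indicator {z. \<not> (\<bar>Re z\<bar> \<noteq> a \<and> \<bar>Im z\<bar> \<noteq> a)} z \<partial>lborel)"
    by (simp add: nn_integral_indicator)
  also have "\<dots> = (\<integral>\<^sup>+x. \<integral>\<^sup>+y. indicator {z. \<not> (\<bar>Re z\<bar> \<noteq> a \<and> \<bar>Im z\<bar> \<noteq> a)} (Complex x y) \<partial>lborel \<partial>lborel)"
    by (rule nn_integral_lborel_complex) measurable
  also have "\<dots> = (\<integral>\<^sup>+x. \<integral>\<^sup>+y. 0 \<partial>(lborel :: real measure) \<partial>(lborel :: real measure))"
  proof (rule nn_integral_cong_AE, use * in eventually_elim)
    fix x assume x: "\<bar>x :: real\<bar> \<noteq> a"
    show "(\<integral>\<^sup>+y. indicator {z. \<not> (\<bar>Re z\<bar> \<noteq> a \<and> \<bar>Im z\<bar> \<noteq> a)} (Complex x y) \<partial>lborel) = (\<integral>\<^sup>+y. 0 \<partial>(lborel :: real measure))"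
      by (rule nn_integral_cong_AE, use * in eventually_elim) (use x in simp)
  qed
  finally have "emeasure lborel {z. \<not> (\<bar>Re z\<bar> \<noteq> a \<and> \<bar>Im z\<bar> \<noteq> a)} = 0" by simp
  then show ?thesis
    by (subst AE_iff_measurable[OF _ refl]) simp_all
qed

text \<open>Dividing by \<open>h\<close> rotates the noise and scales its variance by \<open>1 / (cmod h)\<^sup>2\<close>.\<close>

lemma cgauss_density_mult:
  assumes "v > 0" "h \<noteq> 0"
  shows "(cmod h)\<^sup>2 * cgauss_density v (h * u) = cgauss_density (v / (cmod h)\<^sup>2) u"
  using assms by (simp add: cgauss_density_def norm_mult power_mult_distrib field_simps)

lemma nn_integral_cgauss_rectangle:
  assumes "v > 0" and [measurable]: "A \<in> sets borel" "B \<in> sets borel"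
  shows "(\<integral>\<^sup>+u. ennreal (cgauss_density v u) * indicator {u. Re u \<in> A \<and> Im u \<in> B} u \<partial>lborel)
    = ennreal (measure (density lborel (normal_density 0 (sqrt v))) A
             * measure (density lborel (normal_density 0 (sqrt v))) B)"
proof -
  let ?n = "normal_density 0 (sqrt v)"
  interpret N: prob_space "density lborel ?n"
    using assms by (intro prob_space_normal_density) simp
  have "(\<integral>\<^sup>+u. ennreal (cgauss_density v u) * indicator {u. Re u \<in> A \<and> Im u \<in> B} u \<partial>lborel)
    = (\<integral>\<^sup>+x. \<integral>\<^sup>+y. (ennreal (?n x) * indicator A x) * (ennreal (?n y) * indicator B y) \<partial>lborel \<partial>lborel)"
    using assms(1)
    by (subst nn_integral_lborel_complex)
       (auto intro!: nn_integral_cong simp: cgauss_density_Complex ennreal_mult indicator_def)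
  also have "\<dots> = (\<integral>\<^sup>+x. ennreal (?n x) * indicator A x \<partial>lborel) * (\<integral>\<^sup>+y. ennreal (?n y) * indicator B y \<partial>lborel)"
    by (simp add: nn_integral_cmult nn_integral_multc)
  also have "\<dots> = emeasure (density lborel ?n) A * emeasure (density lborel ?n) B"
    by (simp add: emeasure_density)
  finally show ?thesis
    by (simp add: N.emeasure_eq_measure ennreal_mult)
qed

text \<open>Substituting \<open>z = h * u\<close> turns the received signal into
  \<open>h * (s + u)\<close>. The factor |h| then cancels from all distance comparisons, and the
  decision regions become rectangles parallel to the axes.\<close>

lemma nn_integral_nearest_point_correct:
  fixes \<delta> :: "complex \<Rightarrow> complex"
  assumes size: "MI \<ge> 1" "MQ \<ge> 1" "MI * MQ \<ge> 2" "P > 0"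
    and v: "v > 0" and h: "h \<noteq> 0" and iq: "i < MI" "q < MQ"
    and [measurable]: "\<delta> \<in> borel_measurable borel"
    and mem: "\<And>y. \<delta> y \<in> constellation MI MQ P"
    and nearest: "\<And>y x. x \<in> constellation MI MQ P \<Longrightarrow> cmod (y - h * \<delta> y) \<le> cmod (y - h * x)"
  defines "s \<equiv> qam_point MI MQ P (i, q)"
    and "r \<equiv> sqrt (v / (cmod h)\<^sup>2)"
    and "a \<equiv> d_min MI MQ P / 2"
  shows "(\<integral>\<^sup>+z. ennreal (cgauss_density v z) * indicator {z. \<delta> (h * s + z) = s} z \<partial>lborel)
    = ennreal (measure (density lborel (normal_density 0 r)) (decision_cell MI a i)
             * measure (density lborel (normal_density 0 r)) (decision_cell MQ a q))"
proof -
  have "(\<integral>\<^sup>+z. ennreal (cgauss_density v z) * indicator {z. \<delta> (h * s + z) = s} z \<partial>lborel)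
    = (cmod h)\<^sup>2 * (\<integral>\<^sup>+u. ennreal (cgauss_density v (h * u)) * indicator {z. \<delta> (h * s + z) = s} (h * u) \<partial>lborel)"
    by (rule nn_integral_lborel_complex_mult[OF _ h]) measurable
  also have "\<dots> = (\<integral>\<^sup>+u. ennreal ((cmod h)\<^sup>2 * cgauss_density v (h * u)) * indicator {z. \<delta> (h * s + z) = s} (h * u) \<partial>lborel)"
    using v by (simp add: nn_integral_cmult[symmetric] ennreal_mult cgauss_density_nonneg mult.assoc)
  also have "\<dots> = (\<integral>\<^sup>+u. ennreal (cgauss_density (v / (cmod h)\<^sup>2) u)
      * indicator {u. Re u \<in> decision_cell MI a i \<and> Im u \<in> decision_cell MQ a q} u \<partial>lborel)"
    unfolding cgauss_density_mult[OF v h]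
  proof (rule nn_integral_cong_AE, use AE_lborel_complex_Re_Im_neq[of a] in eventually_elim)
    fix u assume u: "\<bar>Re u\<bar> \<noteq> a \<and> \<bar>Im u\<bar> \<noteq> a"
    have "\<delta> (h * s + h * u) = qam_point MI MQ P (i, q) \<longleftrightarrow>
       Re u \<in> decision_cell MI (d_min MI MQ P / 2) i \<and> Im u \<in> decision_cell MQ (d_min MI MQ P / 2) q"
    proof (rule nearest_qam_point_iff[OF size iq _ _ mem])
      fix x' assume "x' \<in> constellation MI MQ P"
      from nearest[OF this, of "h * s + h * u"]
      have "cmod h * cmod (s + u - \<delta> (h * s + h * u)) \<le> cmod h * cmod (s + u - x')"
        by (simp add: algebra_simps flip: norm_mult)
      then show "cmod (qam_point MI MQ P (i, q) + u - \<delta> (h * s + h * u)) \<le> cmod (qam_point MI MQ P (i, q) + u - x')"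
        using h by (simp add: s_def)
    qed (use u in \<open>auto simp: a_def\<close>)
    then show "ennreal (cgauss_density (v / (cmod h)\<^sup>2) u) * indicator {z. \<delta> (h * s + z) = s} (h * u)
      = ennreal (cgauss_density (v / (cmod h)\<^sup>2) u)
      * indicator {u. Re u \<in> decision_cell MI a i \<and> Im u \<in> decision_cell MQ a q} u"
      by (simp add: indicator_def s_def a_def)
  qed
  also have "\<dots> = ennreal (measure (density lborel (normal_density 0 r)) (decision_cell MI a i)
             * measure (density lborel (normal_density 0 r)) (decision_cell MQ a q))"
    unfolding r_def using v h by (intro nn_integral_cgauss_rectangle) auto
  finally show ?thesis .
qed

text \<open>The argument of \<open>Qfun\<close> is half the minimum distance over the standard deviation of the
  rotated noise component.\<close>

definition qam_correct_prob :: "nat \<Rightarrow> nat \<Rightarrow> real \<Rightarrow> real \<Rightarrow> real \<Rightarrow> real" where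
  "qam_correct_prob MI MQ v P x =
     (let e = Qfun (sqrt (3 * P / (((real MI)\<^sup>2 + (real MQ)\<^sup>2 - 2) * v) * x))
      in (1 - 2 * (1 - 1 / real MI) * e) * (1 - 2 * (1 - 1 / real MQ) * e))"

text \<open>Each summand is a product of one factor per axis, so the double sum is the product of
  two sums of the form computed by \<open>sum_measure_decision_cell\<close>.\<close>

lemma sum_measure_decision_cells:
  assumes size: "MI \<ge> 1" "MQ \<ge> 1" "MI * MQ \<ge> 2" "P > 0" and v: "v > 0" and h: "h \<noteq> 0"
  defines "r \<equiv> sqrt (v / (cmod h)\<^sup>2)" and "a \<equiv> d_min MI MQ P / 2"
  shows "(\<Sum>(i, q)\<in>{..<MI} \<times> {..<MQ}.
      measure (density lborel (normal_density 0 r)) (decision_cell MI a i)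
    * measure (density lborel (normal_density 0 r)) (decision_cell MQ a q))
    = real (MI * MQ) * qam_correct_prob MI MQ v P ((cmod h)\<^sup>2)"
proof -
  define D where "D = (real MI)\<^sup>2 + (real MQ)\<^sup>2 - 2"
  have D: "D > 0" using qam_size_pos[OF size(1-3)] by (simp add: D_def)
  have r: "r > 0" using v h by (simp add: r_def)
  have a: "a \<ge> 0" using d_min_pos[OF size] by (simp add: a_def)
  have "a = sqrt (3 * P / D)"
  proof -
    \<comment> \<open>The half in \<open>a\<close> enters the root as 1/4, and 12 / 4 = 3.\<close>
    have "12 * P / D = 2\<^sup>2 * (3 * P / D)" by simp
    then have "sqrt (12 * P / D) = 2 * sqrt (3 * P / D)"
      by (simp only: real_sqrt_mult real_sqrt_abs abs_numeral)
    then show ?thesis by (simp add: a_def d_min_def D_def)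
  qed
  then have ar: "a / r = sqrt (3 * P / (D * v) * (cmod h)\<^sup>2)"
    by (simp add: r_def real_sqrt_divide[symmetric])
  show ?thesis
    unfolding sum.cartesian_product[symmetric] sum_distrib_left[symmetric] sum_distrib_right[symmetric]
      sum_measure_decision_cell[OF r a size(1)] sum_measure_decision_cell[OF r a size(2)] ar
    by (simp add: qam_correct_prob_def D_def Let_def)
qed

text \<open>The tail at a nonnegative argument is at most 1/2, so both factors lie between 0 and 1.
  These bounds supply integrability in the fading averages.\<close>

lemma qam_correct_prob_bounds:
  assumes "MI \<ge> 1" "MQ \<ge> 1" "MI * MQ \<ge> 2" "P > 0" "v > 0" "x \<ge> 0"
  shows "0 \<le> qam_correct_prob MI MQ v P x" "qam_correct_prob MI MQ v P x \<le> 1"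
proof -
  define e where "e = Qfun (sqrt (3 * P / (((real MI)\<^sup>2 + (real MQ)\<^sup>2 - 2) * v) * x))"
  have "e \<le> Qfun 0"
    unfolding e_def using qam_size_pos[OF assms(1-3)] assms(4-6) by (intro Qfun_antimono) simp
  then have e: "0 \<le> e" "e \<le> 1 / 2" by (simp_all add: e_def Qfun_nonneg Qfun_0)
  have *: "0 \<le> 1 - 2 * (1 - 1 / real m) * e \<and> 1 - 2 * (1 - 1 / real m) * e \<le> 1" if "m \<ge> 1" for m
  proof -
    have m: "0 \<le> 1 - 1 / real m" "1 - 1 / real m \<le> 1" using that by simp_all
    have "(1 - 1 / real m) * e \<le> 1 * (1 / 2)" using m e by (intro mult_mono) auto
    moreover have "0 \<le> (1 - 1 / real m) * e" using m e by simp
    ultimately show ?thesis by linarith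
  qed
  show "0 \<le> qam_correct_prob MI MQ v P x" "qam_correct_prob MI MQ v P x \<le> 1"
    using *[OF assms(1)] *[OF assms(2)]
    unfolding qam_correct_prob_def Let_def e_def[symmetric]
    by (auto intro: mult_le_one mult_nonneg_nonneg)
qed

lemma borel_measurable_qam_correct_prob[measurable]:
  assumes [measurable]: "f \<in> borel_measurable M" "g \<in> borel_measurable M"
  shows "(\<lambda>z. qam_correct_prob MI MQ v (f z) (g z)) \<in> borel_measurable M"
  unfolding qam_correct_prob_def Let_def by measurable

lemma qam_error_prob_eq:
  fixes MI MQ :: nat
  defines "c P v \<equiv> 3 * P / (((real MI)\<^sup>2 + (real MQ)\<^sup>2 - 2) * v)"
  shows "1 - qam_correct_prob MI MQ v P x =
    2 * (2 - 1 / real MI - 1 / real MQ) * Qfun (sqrt (c P v * x))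
    - 4 * (1 - 1 / real MI) * (1 - 1 / real MQ) * (Qfun (sqrt (c P v * x)))\<^sup>2"
proof -
  have "1 - (1 - 2 * A * e) * (1 - 2 * B * e) = 2 * (A + B) * e - 4 * A * B * e\<^sup>2" for A B e :: real
    by (simp add: algebra_simps power2_eq_square)
  from this[of "1 - 1 / real MI" _ "1 - 1 / real MQ"] show ?thesis
    by (simp add: qam_correct_prob_def Let_def c_def)
qed

subsection \<open>The MAP detector\<close>

text \<open>For fixed \<open>w\<close> the variable \<open>n\<close> is translated to
  \<open>z = n + w\<close>, which requires integrating over \<open>n\<close> on the inside.\<close>

lemma nn_integral_convolution:
  fixes f g :: "complex \<Rightarrow> ennreal"
  assumes [measurable]: "f \<in> borel_measurable borel" "g \<in> borel_measurable borel" "F \<in> borel_measurable borel"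
  shows "(\<integral>\<^sup>+n. \<integral>\<^sup>+w. F (n + w) \<partial>density lborel g \<partial>density lborel f)
    = (\<integral>\<^sup>+z. F z * (\<integral>\<^sup>+w. f (z - w) * g w \<partial>lborel) \<partial>lborel)"
proof -
  have "(\<integral>\<^sup>+n. \<integral>\<^sup>+w. F (n + w) \<partial>density lborel g \<partial>density lborel f)
      = (\<integral>\<^sup>+n. \<integral>\<^sup>+w. f n * (g w * F (n + w)) \<partial>lborel \<partial>lborel)"
    by (simp add: nn_integral_density nn_integral_cmult)
  also have "\<dots> = (\<integral>\<^sup>+w. \<integral>\<^sup>+n. f n * (g w * F (n + w)) \<partial>lborel \<partial>lborel)"
    by (rule lborel_pair.Fubini') measurable
  also have "\<dots> = (\<integral>\<^sup>+w. \<integral>\<^sup>+z. f (z - w) * (g w * F (z - w + w)) \<partial>lborel \<partial>lborel)"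
    by (intro nn_integral_cong nn_integral_lborel_translate[symmetric]) measurable
  also have "\<dots> = (\<integral>\<^sup>+z. \<integral>\<^sup>+w. F z * (f (z - w) * g w) \<partial>lborel \<partial>lborel)"
    by (subst lborel_pair.Fubini') (auto simp: mult_ac)
  also have "\<dots> = (\<integral>\<^sup>+z. F z * (\<integral>\<^sup>+w. f (z - w) * g w \<partial>lborel) \<partial>lborel)"
    by (simp add: nn_integral_cmult)
  finally show ?thesis .
qed

context sensing_channel
begin

abbreviation "fn \<equiv> cgauss_density (\<sigma>n\<^sup>2)"
abbreviation "fw \<equiv> gauss_mixture_density p lam \<sigma>"

lemma borel_measurable_fw[measurable]: "fw \<in> borel_measurable borel"
  unfolding gauss_mixture_density_def[abs_def] by measurable

lemma fw_nonneg: "0 \<le> fw z"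
  unfolding gauss_mixture_density_def using weight_nonneg comp_var_pos
  by (intro sum_nonneg mult_nonneg_nonneg cgauss_density_nonneg) auto

lemma component_var_pos: "l \<in> {1..p} \<Longrightarrow> (\<sigma> l)\<^sup>2 + \<sigma>n\<^sup>2 > 0"
  by (intro add_pos_pos comp_var_pos noise_var_pos)

text \<open>This rests on \<open>decision_pos\<close>: given a null decision, both quotients would
  be 0 by the convention for division by zero.\<close>

lemma cond_prob_compl:
  "\<P>(\<omega> in M. \<not> H \<omega> \<bar> Hhat \<omega> = k) = 1 - \<P>(\<omega> in M. H \<omega> \<bar> Hhat \<omega> = k)"
proof -
  note [measurable] = measurable_state
  have "\<P>(\<omega> in M. \<not> H \<omega> \<and> Hhat \<omega> = k) + \<P>(\<omega> in M. H \<omega> \<and> Hhat \<omega> = k)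
     = prob ({\<omega> \<in> space M. \<not> H \<omega> \<and> Hhat \<omega> = k} \<union> {\<omega> \<in> space M. H \<omega> \<and> Hhat \<omega> = k})"
    by (rule finite_measure_Union[symmetric]) auto
  also have "{\<omega> \<in> space M. \<not> H \<omega> \<and> Hhat \<omega> = k} \<union> {\<omega> \<in> space M. H \<omega> \<and> Hhat \<omega> = k} = {\<omega> \<in> space M. Hhat \<omega> = k}"
    by auto
  finally show ?thesis
    using decision_pos[of k] by (simp add: cond_prob_def field_simps)
qed

lemma map_metric_strict_antimono:
  assumes "cmod (y - h' * s) < cmod (y - h' * s')"
  shows "map_metric M H Hhat fn fw k h' y s' < map_metric M H Hhat fn fw k h' y s"
proof -
  define \<pi> where "\<pi> = \<P>(\<omega> in M. H \<omega> \<bar> Hhat \<omega> = k)"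
  let ?a = "\<lambda>s. fn (y - h' * s)"
  let ?b = "\<lambda>s. \<Sum>l=1..p. lam l * cgauss_density (\<sigma>n\<^sup>2 + (\<sigma> l)\<^sup>2) (y - h' * s)"
  have rx: "map_metric M H Hhat fn fw k h' y s = (1 - \<pi>) * ?a s + \<pi> * ?b s" for s
    unfolding map_metric_def cond_prob_compl \<pi>_def[symmetric]
    using noise_var_pos comp_var_pos by (subst rx_density_gauss_mixture) (auto simp: rx_density_def)
  have "\<pi> \<ge> 0" "1 - \<pi> \<ge> 0"
    unfolding \<pi>_def cond_prob_compl[symmetric] by (simp_all add: cond_prob_def)
  have a: "?a s' < ?a s"
    by (rule cgauss_density_strict_antimono[OF noise_var_pos assms])
  have c: "cgauss_density (\<sigma>n\<^sup>2 + (\<sigma> l)\<^sup>2) (y - h' * s') < cgauss_density (\<sigma>n\<^sup>2 + (\<sigma> l)\<^sup>2) (y - h' * s)"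
    if "l \<in> {1..p}" for l
    by (rule cgauss_density_strict_antimono[OF add_pos_pos[OF noise_var_pos comp_var_pos[OF that]] assms])
  \<comment> \<open>A weight may be 0, so strictness of the mixture needs one positive weight; the
    weights sum to 1.\<close>
  obtain l where l: "l \<in> {1..p}" "lam l > 0"
  proof (rule ccontr)
    assume "\<not> thesis"
    then have "(\<Sum>l=1..p. lam l) \<le> 0" using that by (intro sum_nonpos) force
    then show False using weight_sum by simp
  qed
  have b: "?b s' < ?b s"
  proof (rule sum_strict_mono_ex1)
    show "\<forall>l\<in>{1..p}. lam l * cgauss_density (\<sigma>n\<^sup>2 + (\<sigma> l)\<^sup>2) (y - h' * s')
        \<le> lam l * cgauss_density (\<sigma>n\<^sup>2 + (\<sigma> l)\<^sup>2) (y - h' * s)"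
      by (intro ballI mult_left_mono less_imp_le[OF c] weight_nonneg)
    show "\<exists>l\<in>{1..p}. lam l * cgauss_density (\<sigma>n\<^sup>2 + (\<sigma> l)\<^sup>2) (y - h' * s')
        < lam l * cgauss_density (\<sigma>n\<^sup>2 + (\<sigma> l)\<^sup>2) (y - h' * s)"
      using mult_strict_left_mono[OF c[OF l(1)] l(2)] l(1) by (rule bexI)
  qed simp
  show ?thesis
  \<comment> \<open>Either posterior weight may vanish, so the strict inequality is taken from the
    noise term if \<open>\<pi> = 0\<close> and from the mixture term otherwise.\<close>
  proof (cases "\<pi> = 0")
    case True
    then show ?thesis unfolding rx using a by simp
  next
    case False
    then have "(1 - \<pi>) * ?a s' + \<pi> * ?b s' < (1 - \<pi>) * ?a s + \<pi> * ?b s"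
      using \<open>\<pi> \<ge> 0\<close> \<open>1 - \<pi> \<ge> 0\<close> a b by (intro add_le_less_mono mult_left_mono mult_strict_left_mono) auto
    then show ?thesis unfolding rx .
  qed
qed

text \<open>A strictly closer point would have a strictly larger metric. The posterior weights leave
  no trace in the conclusion, which is why the sensing decision drops out from here on.\<close>

lemma MAP_detector_nearest:
  assumes "is_MAP_detector M H Hhat fn fw MI MQ \<delta>" "P > 0"
  shows "\<delta> k P h' y \<in> constellation MI MQ P"
    and "x \<in> constellation MI MQ P \<Longrightarrow> cmod (y - h' * \<delta> k P h' y) \<le> cmod (y - h' * x)"
proof -
  have *: "is_arg_max (map_metric M H Hhat fn fw k h' y) (\<lambda>s. s \<in> constellation MI MQ P) (\<delta> k P h' y)"
    using assms by (simp add: is_MAP_detector_def)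
  then show "\<delta> k P h' y \<in> constellation MI MQ P" by (simp add: is_arg_max_def)
  assume "x \<in> constellation MI MQ P"
  then show "cmod (y - h' * \<delta> k P h' y) \<le> cmod (y - h' * x)"
    using * map_metric_strict_antimono[of y h' x "\<delta> k P h' y" k] by (force simp: is_arg_max_def)
qed

lemma MAP_detector_measurable:
  assumes "is_MAP_detector M H Hhat fn fw MI MQ \<delta>"
    and [measurable]: "f \<in> borel_measurable N" "f1 \<in> borel_measurable N" "f2 \<in> borel_measurable N"
  shows "(\<lambda>x. \<delta> k (f x) (f1 x) (f2 x)) \<in> borel_measurable N"
proof -
  have [measurable]: "(\<lambda>(P, h, y). \<delta> k P h y) \<in> borel_measurable borel"
    using assms(1) by (auto simp: is_MAP_detector_def)
  have "(\<lambda>x. (f x, f1 x, f2 x)) \<in> borel_measurable N" by measurable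
  from measurable_compose[OF this, of "\<lambda>(P, h, y). \<delta> k P h y" borel] show ?thesis by simp
qed

text \<open>The success probability given the true state \<open>j\<close>, with \<open>x\<close>
  standing for |h|^2. It takes no sensing decision as argument, because the nearest point does not
  depend on it.\<close>

definition correct_prob :: "bool \<Rightarrow> real \<Rightarrow> real \<Rightarrow> real" where
  "correct_prob j P x = (if j then (\<Sum>l=1..p. lam l * qam_correct_prob MI MQ ((\<sigma> l)\<^sup>2 + \<sigma>n\<^sup>2) P x)
     else qam_correct_prob MI MQ (\<sigma>n\<^sup>2) P x)"

lemma distr_noise: "distr M borel noise = density lborel fn"
  using distributed_distr_eq_density[OF noise_law] by (simp cong: distr_cong)

lemma distr_w: "distr M borel w = density lborel fw"
  using distributed_distr_eq_density[OF interference_law] by (simp cong: distr_cong)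

text \<open>The total disturbance has a mixture of circular Gaussian densities in either state, so
  the nearest-point computation can be applied to one component at a time.\<close>

lemma nn_integral_noise_interference:
  assumes [measurable]: "F \<in> borel_measurable borel"
  shows "(\<integral>\<^sup>+n. \<integral>\<^sup>+u. F (n + (if j then u else 0)) \<partial>distr M borel w \<partial>distr M borel noise)
    = (if j then (\<Sum>l=1..p. ennreal (lam l) * (\<integral>\<^sup>+z. ennreal (cgauss_density ((\<sigma> l)\<^sup>2 + \<sigma>n\<^sup>2) z) * F z \<partial>lborel))
       else (\<integral>\<^sup>+z. ennreal (fn z) * F z \<partial>lborel))"
proof (cases j)
  case False
  have "random_variable borel w" using interference_law by (auto simp: distributed_def)
  then interpret W: prob_space "distr M borel w" by (rule prob_space_distr)
  have "(\<integral>\<^sup>+n. \<integral>\<^sup>+u. F (n + (if j then u else 0)) \<partial>distr M borel w \<partial>distr M borel noise)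
    = (\<integral>\<^sup>+n. F n \<partial>distr M borel noise)"
    using False W.emeasure_space_1 by simp
  then show ?thesis
    using False by (simp add: distr_noise nn_integral_density)
next
  case True
  have conv: "(\<integral>\<^sup>+u. ennreal (fn (z - u)) * ennreal (fw u) \<partial>lborel)
     = (\<Sum>l=1..p. ennreal (lam l) * ennreal (cgauss_density ((\<sigma> l)\<^sup>2 + \<sigma>n\<^sup>2) z))" for z
  proof -
    have "(\<integral>\<^sup>+u. ennreal (fn (z - u)) * ennreal (fw u) \<partial>lborel)
      = (\<integral>\<^sup>+u. (\<Sum>l=1..p. ennreal (lam l) * ennreal (fn (z - u) * cgauss_density ((\<sigma> l)\<^sup>2) u)) \<partial>lborel)"
    proof (intro nn_integral_cong)
      fix u
      have nn: "0 \<le> fn (z - u) * cgauss_density ((\<sigma> l)\<^sup>2) u" if "l \<in> {1..p}" for l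
        using noise_var_pos comp_var_pos[OF that] by (intro mult_nonneg_nonneg cgauss_density_nonneg)
      have "ennreal (fn (z - u)) * ennreal (fw u) = ennreal (fn (z - u) * fw u)"
        using noise_var_pos by (intro ennreal_mult[symmetric] cgauss_density_nonneg fw_nonneg)
      also have "fn (z - u) * fw u = (\<Sum>l=1..p. lam l * (fn (z - u) * cgauss_density ((\<sigma> l)\<^sup>2) u))"
        by (simp add: gauss_mixture_density_def sum_distrib_left mult_ac)
      also have "ennreal \<dots> = (\<Sum>l=1..p. ennreal (lam l * (fn (z - u) * cgauss_density ((\<sigma> l)\<^sup>2) u)))"
        by (intro sum_ennreal[symmetric] mult_nonneg_nonneg[OF weight_nonneg nn])
      also have "\<dots> = (\<Sum>l=1..p. ennreal (lam l) * ennreal (fn (z - u) * cgauss_density ((\<sigma> l)\<^sup>2) u))"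
        by (intro sum.cong refl ennreal_mult weight_nonneg nn)
      finally show "ennreal (fn (z - u)) * ennreal (fw u) = \<dots>" .
    qed
    also have "\<dots> = (\<Sum>l=1..p. ennreal (lam l) * (\<integral>\<^sup>+u. ennreal (fn (z - u) * cgauss_density ((\<sigma> l)\<^sup>2) u) \<partial>lborel))"
      by (simp add: nn_integral_sum nn_integral_cmult)
    also have "\<dots> = (\<Sum>l=1..p. ennreal (lam l) * ennreal (cgauss_density ((\<sigma> l)\<^sup>2 + \<sigma>n\<^sup>2) z))"
      using noise_var_pos comp_var_pos
      by (intro sum.cong refl arg_cong2[where f="(*)"]) (simp add: nn_integral_cgauss_conv add.commute)
    finally show ?thesis .
  qed
  have "(\<integral>\<^sup>+n. \<integral>\<^sup>+u. F (n + (if j then u else 0)) \<partial>distr M borel w \<partial>distr M borel noise)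
    = (\<integral>\<^sup>+z. F z * (\<integral>\<^sup>+u. ennreal (fn (z - u)) * ennreal (fw u) \<partial>lborel) \<partial>lborel)"
    using True unfolding distr_noise distr_w by (simp add: nn_integral_convolution)
  also have "\<dots> = (\<integral>\<^sup>+z. (\<Sum>l=1..p. ennreal (lam l) * (ennreal (cgauss_density ((\<sigma> l)\<^sup>2 + \<sigma>n\<^sup>2) z) * F z)) \<partial>lborel)"
    unfolding conv by (intro nn_integral_cong) (simp add: sum_distrib_left mult_ac)
  also have "\<dots> = (\<Sum>l=1..p. ennreal (lam l) * (\<integral>\<^sup>+z. ennreal (cgauss_density ((\<sigma> l)\<^sup>2 + \<sigma>n\<^sup>2) z) * F z \<partial>lborel))"
    by (simp add: nn_integral_sum nn_integral_cmult)
  finally show ?thesis using True by simp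
qed

lemma correct_prob_bounds:
  assumes "P > 0" "x \<ge> 0"
  shows "0 \<le> correct_prob j P x" "correct_prob j P x \<le> 1"
proof -
  have q: "0 \<le> qam_correct_prob MI MQ ((\<sigma> l)\<^sup>2 + \<sigma>n\<^sup>2) P x \<and> qam_correct_prob MI MQ ((\<sigma> l)\<^sup>2 + \<sigma>n\<^sup>2) P x \<le> 1"
    if "l \<in> {1..p}" for l
    by (intro conjI qam_correct_prob_bounds size assms component_var_pos that)
  have "(\<Sum>l=1..p. lam l * qam_correct_prob MI MQ ((\<sigma> l)\<^sup>2 + \<sigma>n\<^sup>2) P x) \<le> (\<Sum>l=1..p. lam l * 1)"
    using q weight_nonneg by (intro sum_mono mult_left_mono) auto
  then show "0 \<le> correct_prob j P x" "correct_prob j P x \<le> 1"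
    using q weight_nonneg weight_sum qam_correct_prob_bounds[OF size assms(1) noise_var_pos assms(2)]
    by (auto simp: correct_prob_def intro!: sum_nonneg)
qed


text \<open>State, power and fading are fixed; symbol, noise and interference are averaged out. The
  decision \<open>k\<close> occurs only on the left-hand side.\<close>

lemma nn_integral_MAP_correct:
  assumes MAP: "is_MAP_detector M H Hhat fn fw MI MQ \<delta>" and P: "P > 0" and h': "h' \<noteq> 0"
  shows "(\<integral>\<^sup>+c. \<integral>\<^sup>+n. \<integral>\<^sup>+u. indicator {(c, z). \<delta> k P h' (h' * qam_point MI MQ P c + z) = qam_point MI MQ P c} (c, n + (if j then u else 0))
       \<partial>distr M borel w \<partial>distr M borel noise \<partial>distr M (count_space UNIV) idx)
    = ennreal (correct_prob j P ((cmod h')\<^sup>2))"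
proof -
  define D where "D = \<delta> k P h'"
  have [measurable]: "D \<in> borel_measurable borel"
    unfolding D_def
    by (rule MAP_detector_measurable[OF MAP, of "\<lambda>_. P" borel "\<lambda>_. h'" "\<lambda>z. z" k])
       (rule borel_measurable_const borel_measurable_const measurable_ident_sets[OF refl])+
  define r a where "r v = sqrt (v / (cmod h')\<^sup>2)" and "a = d_min MI MQ P / 2" for v
  define I where "I v = (\<lambda>(i, q). measure (density lborel (normal_density 0 (r v))) (decision_cell MI a i)
      * measure (density lborel (normal_density 0 (r v))) (decision_cell MQ a q))" for v
  let ?S = "{..<MI} \<times> {..<MQ}"
  let ?F = "\<lambda>c. indicator {z. D (h' * qam_point MI MQ P c + z) = qam_point MI MQ P c} :: complex \<Rightarrow> ennreal"
  have inner: "(\<integral>\<^sup>+z. ennreal (cgauss_density v z) * ?F c z \<partial>lborel) = ennreal (I v c)"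
    if v: "v > 0" and c: "c \<in> ?S" for v c
  proof -
    obtain i q where iq: "c = (i, q)" "i < MI" "q < MQ" using c by auto
    show ?thesis
      unfolding I_def iq prod.case r_def a_def
      by (rule nn_integral_nearest_point_correct[OF size P v h' iq(2,3) \<open>D \<in> borel_measurable borel\<close>])
         (unfold D_def, rule MAP_detector_nearest[OF MAP P], rule MAP_detector_nearest[OF MAP P])
  qed
  have I_nn: "I v c \<ge> 0" for v c by (auto simp: I_def split: prod.split)
  have sumI: "(\<Sum>c\<in>?S. I v c) = real (MI * MQ) * qam_correct_prob MI MQ v P ((cmod h')\<^sup>2)" if "v > 0" for v
    unfolding I_def r_def a_def using that by (rule sum_measure_decision_cells[OF size P _ h'])
  have S: "finite ?S" "?S \<noteq> {}" "card ?S = MI * MQ" using size by (auto simp: lessThan_empty_iff)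
  have pos: "real (MI * MQ) > 0" using size by simp
  \<comment> \<open>\<open>T c\<close> is the probability that the symbol with index
    \<open>c\<close> is received correctly in state \<open>j\<close>.\<close>
  define T where "T c = (if j then (\<Sum>l=1..p. lam l * I ((\<sigma> l)\<^sup>2 + \<sigma>n\<^sup>2) c) else I (\<sigma>n\<^sup>2) c)" for c
  have T_nn: "T c \<ge> 0" for c
    unfolding T_def by (cases j; simp only: if_True if_False) (intro sum_nonneg mult_nonneg_nonneg weight_nonneg I_nn | assumption)+
  have T: "(\<integral>\<^sup>+n. \<integral>\<^sup>+u. ?F c (n + (if j then u else 0)) \<partial>distr M borel w \<partial>distr M borel noise) = ennreal (T c)"
    if c: "c \<in> ?S" for c
  proof -
    have "(\<Sum>l=1..p. ennreal (lam l) * (\<integral>\<^sup>+z. ennreal (cgauss_density ((\<sigma> l)\<^sup>2 + \<sigma>n\<^sup>2) z) * ?F c z \<partial>lborel))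
      = (\<Sum>l=1..p. ennreal (lam l * I ((\<sigma> l)\<^sup>2 + \<sigma>n\<^sup>2) c))"
      by (intro sum.cong refl) (simp only: inner[OF component_var_pos c] ennreal_mult[OF weight_nonneg I_nn])
    also have "\<dots> = ennreal (\<Sum>l=1..p. lam l * I ((\<sigma> l)\<^sup>2 + \<sigma>n\<^sup>2) c)"
      by (intro sum_ennreal mult_nonneg_nonneg weight_nonneg I_nn)
    finally have 1: "(\<Sum>l=1..p. ennreal (lam l) * (\<integral>\<^sup>+z. ennreal (cgauss_density ((\<sigma> l)\<^sup>2 + \<sigma>n\<^sup>2) z) * ?F c z \<partial>lborel))
      = ennreal (\<Sum>l=1..p. lam l * I ((\<sigma> l)\<^sup>2 + \<sigma>n\<^sup>2) c)" .
    have [measurable]: "?F c \<in> borel_measurable borel" by measurable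
    show ?thesis
      unfolding nn_integral_noise_interference[OF \<open>?F c \<in> borel_measurable borel\<close>]
        1 inner[OF noise_var_pos c] T_def by (rule if_distrib[of ennreal, symmetric])
  qed
  have "(\<integral>\<^sup>+c. \<integral>\<^sup>+n. \<integral>\<^sup>+u. indicator {(c, z). D (h' * qam_point MI MQ P c + z) = qam_point MI MQ P c} (c, n + (if j then u else 0))
       \<partial>distr M borel w \<partial>distr M borel noise \<partial>distr M (count_space UNIV) idx)
    = (\<integral>\<^sup>+c. \<integral>\<^sup>+n. \<integral>\<^sup>+u. ?F c (n + (if j then u else 0)) \<partial>distr M borel w \<partial>distr M borel noise \<partial>measure_pmf (pmf_of_set ?S))"
    unfolding idx_uniform D_def by (simp add: indicator_def)
  \<comment> \<open>Uniformity of the index divides by the number of points, which cancels the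
    factor \<open>MI * MQ\<close> produced by \<open>sum_measure_decision_cells\<close>.\<close>
  also have "\<dots> = (\<Sum>c\<in>?S. \<integral>\<^sup>+n. \<integral>\<^sup>+u. ?F c (n + (if j then u else 0)) \<partial>distr M borel w \<partial>distr M borel noise) / card ?S"
    by (rule nn_integral_pmf_of_set[OF S(2,1)])
  also have "\<dots> = ennreal (\<Sum>c\<in>?S. T c) / card ?S"
    using T_nn by (simp only: T sum_ennreal cong: sum.cong)
  also have "\<dots> = ennreal ((\<Sum>c\<in>?S. T c) / real (MI * MQ))"
    unfolding S(3) using T_nn pos by (simp only: divide_ennreal[symmetric] sum_nonneg ennreal_of_nat_eq_real_of_nat)
  also have "(\<Sum>c\<in>?S. T c) = real (MI * MQ) * correct_prob j P ((cmod h')\<^sup>2)"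
  proof (cases j)
    case True
    have "(\<Sum>c\<in>?S. T c) = (\<Sum>l=1..p. lam l * (\<Sum>c\<in>?S. I ((\<sigma> l)\<^sup>2 + \<sigma>n\<^sup>2) c))"
      unfolding T_def using True by (simp only: if_True sum_distrib_left, subst sum.swap) simp
    also have "\<dots> = (\<Sum>l=1..p. real (MI * MQ) * (lam l * qam_correct_prob MI MQ ((\<sigma> l)\<^sup>2 + \<sigma>n\<^sup>2) P ((cmod h')\<^sup>2)))"
      by (intro sum.cong refl) (simp only: sumI[OF component_var_pos] mult.left_commute)
    finally show ?thesis using True by (simp add: correct_prob_def sum_distrib_left)
  next
    case False
    then show ?thesis using sumI[OF noise_var_pos] by (simp add: correct_prob_def T_def)
  qed
  also have "real (MI * MQ) * correct_prob j P ((cmod h')\<^sup>2) / real (MI * MQ) = correct_prob j P ((cmod h')\<^sup>2)"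
    by (rule nonzero_mult_div_cancel_left[OF pos[THEN less_imp_neq, THEN not_sym]])
  finally show ?thesis unfolding D_def .
qed

end

subsection \<open>The joint law\<close>

type_synonym channel_outcome =
  "complex \<times> complex \<times> (bool \<times> bool) \<times> (nat \<times> nat) \<times> complex \<times> complex"

context sensing_channel
begin

lemma borel_measurable_correct_prob[measurable]:
  assumes [measurable]: "f1 \<in> borel_measurable N" "f2 \<in> borel_measurable N"
  shows "(\<lambda>z. correct_prob j (f1 z) (f2 z)) \<in> borel_measurable N"
  unfolding correct_prob_def by measurable

text \<open>The weights are the unconditional priors of \<open>H\<close>, since
  \<open>correct_prob\<close> is the same under both sensing decisions.\<close>

definition mean_correct_prob :: "real \<Rightarrow> real \<Rightarrow> real" where
  "mean_correct_prob P x = \<P>(\<omega> in M. \<not> H \<omega>) * correct_prob False P x + \<P>(\<omega> in M. H \<omega>) * correct_prob True P x"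

lemma borel_measurable_mean_correct_prob[measurable]:
  assumes [measurable]: "f1 \<in> borel_measurable N" "f2 \<in> borel_measurable N"
  shows "(\<lambda>z. mean_correct_prob (f1 z) (f2 z)) \<in> borel_measurable N"
  unfolding mean_correct_prob_def by measurable

lemma prob_not_H: "\<P>(\<omega> in M. \<not> H \<omega>) = 1 - \<P>(\<omega> in M. H \<omega>)"
  using measurable_state by (intro prob_neg) simp

lemma mean_correct_prob_bounds:
  assumes "P > 0" "x \<ge> 0"
  shows "0 \<le> mean_correct_prob P x" "mean_correct_prob P x \<le> 1"
proof -
  show "0 \<le> mean_correct_prob P x"
    unfolding mean_correct_prob_def
    by (intro add_nonneg_nonneg mult_nonneg_nonneg measure_nonneg correct_prob_bounds[OF assms])
  have "mean_correct_prob P x \<le> \<P>(\<omega> in M. \<not> H \<omega>) * 1 + \<P>(\<omega> in M. H \<omega>) * 1"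
    unfolding mean_correct_prob_def
    by (intro add_mono mult_left_mono measure_nonneg correct_prob_bounds[OF assms])
  then show "mean_correct_prob P x \<le> 1" by (simp add: prob_not_H)
qed

lemma nn_integral_correct_prob_state:
  assumes P: "P > 0" "x \<ge> 0"
  shows "(\<integral>\<^sup>+s. ennreal (correct_prob (fst s) P x) \<partial>distr M (count_space UNIV) (\<lambda>\<omega>. (H \<omega>, Hhat \<omega>)))
    = ennreal (mean_correct_prob P x)"
proof -
  note [measurable] = measurable_state
  have [measurable]: "(\<lambda>\<omega>. (H \<omega>, Hhat \<omega>)) \<in> M \<rightarrow>\<^sub>M count_space UNIV"
    by (rule measurable_compose_countable[where g=H and f="\<lambda>j \<omega>. (j, Hhat \<omega>)"]) measurable
  note c = correct_prob_bounds(1)[OF P]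
  have "(\<integral>\<^sup>+s. ennreal (correct_prob (fst s) P x) \<partial>distr M (count_space UNIV) (\<lambda>\<omega>. (H \<omega>, Hhat \<omega>)))
    = (\<integral>\<^sup>+\<omega>. ennreal (correct_prob (H \<omega>) P x) \<partial>M)"
    by (subst nn_integral_distr) auto
  also have "\<dots> = (\<integral>\<^sup>+\<omega>. ennreal (correct_prob False P x) * indicator {\<omega> \<in> space M. \<not> H \<omega>} \<omega>
      + ennreal (correct_prob True P x) * indicator {\<omega> \<in> space M. H \<omega>} \<omega> \<partial>M)"
    by (intro nn_integral_cong) (auto simp: indicator_def)
  also have "\<dots> = ennreal (correct_prob False P x) * emeasure M {\<omega> \<in> space M. \<not> H \<omega>}
      + ennreal (correct_prob True P x) * emeasure M {\<omega> \<in> space M. H \<omega>}"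
    by (subst nn_integral_add) (auto simp: nn_integral_cmult_indicator)
  also have "\<dots> = ennreal (mean_correct_prob P x)"
    unfolding emeasure_eq_measure mean_correct_prob_def
    using c by (simp add: ennreal_mult ennreal_plus mult.commute)
  finally show ?thesis .
qed

text \<open>The product law turns the probability of a correct decision into an iterated integral,
  ordered so that index, noise and interference are innermost, with state, power and fading held
  fixed. At \<open>h = 0\<close> all points have equal metric, hence the hypothesis
  \<open>h_neq\<close>.\<close>

lemma symbol_error_prob_MAP:
  assumes MAP: "is_MAP_detector M H Hhat fn fw MI MQ \<delta>"
    and pw[measurable]: "pw \<in> borel_measurable borel" and pw_pos: "\<And>z. pw z > 0"
    and h_neq: "AE \<omega> in M. h \<omega> \<noteq> 0"
  shows "symbol_error_prob M H Hhat idx h g noise w MI MQ (\<lambda>k. pw) \<delta>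
    = 1 - (\<integral>z. \<integral>u. mean_correct_prob (pw z) ((cmod u)\<^sup>2) \<partial>distr M borel h \<partial>distr M borel g)"
proof -
  note [measurable] = measurable_state measurable_idx measurable_fading
  have [measurable]: "random_variable borel noise" "random_variable borel w"
    using noise_law interference_law by (auto simp: distributed_def)
  have [measurable]: "(\<lambda>\<omega>. (H \<omega>, Hhat \<omega>)) \<in> M \<rightarrow>\<^sub>M count_space UNIV"
    by (rule measurable_compose_countable[where g=H and f="\<lambda>j \<omega>. (j, Hhat \<omega>)"]) measurable
  define K :: "channel_outcome measure"
    where "K = borel \<Otimes>\<^sub>M borel \<Otimes>\<^sub>M count_space UNIV \<Otimes>\<^sub>M count_space UNIV \<Otimes>\<^sub>M borel \<Otimes>\<^sub>M borel"
  define Lh Lg Ls Li Ln Lw where L: "Lh = distr M borel h" "Lg = distr M borel g"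
    "Ls = distr M (count_space UNIV) (\<lambda>\<omega>. (H \<omega>, Hhat \<omega>))"
    "Li = distr M (count_space UNIV) idx" "Ln = distr M borel noise" "Lw = distr M borel w"
  interpret Lh: prob_space Lh unfolding L by (rule prob_space_distr) measurable
  interpret Lg: prob_space Lg unfolding L by (rule prob_space_distr) measurable
  interpret Ls: prob_space Ls unfolding L by (rule prob_space_distr) measurable
  interpret Li: prob_space Li unfolding L by (rule prob_space_distr) measurable
  interpret Ln: prob_space Ln unfolding L by (rule prob_space_distr) measurable
  interpret Lw: prob_space Lw unfolding L by (rule prob_space_distr) measurable
  interpret P1: pair_prob_space Ln Lw ..
  interpret P2: pair_prob_space Li "Ln \<Otimes>\<^sub>M Lw" ..
  interpret P3: pair_prob_space Ls "Li \<Otimes>\<^sub>M Ln \<Otimes>\<^sub>M Lw" ..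
  interpret P4: pair_prob_space Lg "Ls \<Otimes>\<^sub>M Li \<Otimes>\<^sub>M Ln \<Otimes>\<^sub>M Lw" ..
  interpret hg: pair_prob_space Lh Lg ..
  have sets_L[measurable_cong]: "sets Lh = sets borel" "sets Lg = sets borel" "sets Ls = sets (count_space UNIV)"
    "sets Li = sets (count_space UNIV)" "sets Ln = sets borel" "sets Lw = sets borel"
    by (simp_all add: L)
  define ok where "ok = (\<lambda>(h', z, (j, k), c, n, u).
     \<delta> k (pw z) h' (h' * qam_point MI MQ (pw z) c + n + (if j then u else 0)) = qam_point MI MQ (pw z) c)"
  have ok_meas[measurable]: "Measurable.pred K ok"
  proof -
    define fh fz fs fc fn' fu where f: "fh = (fst :: channel_outcome \<Rightarrow> complex)" "fz = (\<lambda>t :: channel_outcome. fst (snd t))"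
      "fs = (\<lambda>t :: channel_outcome. fst (snd (snd t)))"
      "fc = (\<lambda>t :: channel_outcome. fst (snd (snd (snd t))))"
      "fn' = (\<lambda>t :: channel_outcome. fst (snd (snd (snd (snd t)))))"
      "fu = (\<lambda>t :: channel_outcome. snd (snd (snd (snd (snd t)))))"
    have [measurable]: "fh \<in> borel_measurable K" "fz \<in> borel_measurable K"
      "fn' \<in> borel_measurable K" "fu \<in> borel_measurable K"
      and s: "fs \<in> K \<rightarrow>\<^sub>M count_space UNIV" and c: "fc \<in> K \<rightarrow>\<^sub>M count_space UNIV"
      unfolding K_def f by measurable
    define S where "S c t = qam_point MI MQ (pw (fz t)) c" for c t
    have [measurable]: "S c \<in> borel_measurable K" for c
      unfolding S_def[abs_def] qam_point_def d_min_def by (cases c) simp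
    define D where "D s c t = \<delta> (snd s) (pw (fz t)) (fh t) (fh t * S c t + fn' t + (if fst s then fu t else 0))" for s c t
    have D[measurable]: "D s c \<in> borel_measurable K" for s c
      unfolding D_def[abs_def] by (rule MAP_detector_measurable[OF MAP]) measurable
    \<comment> \<open>State, decision and index take countably many values, so it suffices to treat
      each fixed value and then substitute the discrete variables.\<close>
    have "Measurable.pred K (\<lambda>t. D s c t = S c t)" for s c by measurable
    then have "Measurable.pred K (\<lambda>t. D (fs t) (fc t) t = S (fc t) t)"
      by (intro measurable_compose_countable[OF _ s, where f="\<lambda>s t. D s (fc t) t = S (fc t) t"]
          measurable_compose_countable[OF _ c, where f="\<lambda>c t. D _ c t = S c t"])
    also have "(\<lambda>t. D (fs t) (fc t) t = S (fc t) t) = ok"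
      by (auto simp: D_def S_def f ok_def fun_eq_iff)
    finally show ?thesis .
  qed
  let ?N = "Lh \<Otimes>\<^sub>M Lg \<Otimes>\<^sub>M Ls \<Otimes>\<^sub>M Li \<Otimes>\<^sub>M Ln \<Otimes>\<^sub>M Lw"
  have sets_N[measurable_cong]: "sets ?N = sets K"
    unfolding K_def by (intro sets_pair_measure_cong sets_L)
  define T where "T = (\<lambda>\<omega>. (h \<omega>, g \<omega>, (H \<omega>, Hhat \<omega>), idx \<omega>, noise \<omega>, w \<omega>))"
  have T[measurable]: "T \<in> M \<rightarrow>\<^sub>M K" unfolding T_def K_def by measurable
  have N: "distr M K T = ?N" unfolding K_def T_def L by (rule independence)
  have spK: "space K = UNIV" by (simp add: K_def space_pair_measure)
  have "symbol_error_prob M H Hhat idx h g noise w MI MQ (\<lambda>k. pw) \<delta> = \<P>(\<omega> in M. \<not> ok (T \<omega>))"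
    by (simp add: symbol_error_prob_def Let_def ok_def T_def)
  also have "\<dots> = 1 - \<P>(\<omega> in M. ok (T \<omega>))"
    by (rule prob_neg) measurable
  also have "\<P>(\<omega> in M. ok (T \<omega>)) = enn2real (emeasure ?N {t. ok t})"
    unfolding measure_def N[symmetric]
    by (subst emeasure_distr) (auto simp: spK pred_def intro!: arg_cong[where f="\<lambda>A. enn2real (emeasure M A)"] ok_meas[unfolded pred_def spK, simplified])
  also have "emeasure ?N {t. ok t} = (\<integral>\<^sup>+t. indicator {t. ok t} t \<partial>?N)"
    using ok_meas by (simp add: sets_N pred_def spK)
  also have "\<dots> = (\<integral>\<^sup>+h'. \<integral>\<^sup>+z. \<integral>\<^sup>+s. \<integral>\<^sup>+c. \<integral>\<^sup>+n. \<integral>\<^sup>+u. indicator {t. ok t} (h', z, s, c, n, u) \<partial>Lw \<partial>Ln \<partial>Li \<partial>Ls \<partial>Lg \<partial>Lh)"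
  proof -
    define f :: "_ \<Rightarrow> ennreal" where "f = indicator {t. ok t}"
    have [measurable]: "f \<in> borel_measurable ?N"
      unfolding f_def using ok_meas by (intro borel_measurable_indicator) (simp add: sets_N pred_def spK)
    have "(\<integral>\<^sup>+t. f t \<partial>?N) = (\<integral>\<^sup>+h'. \<integral>\<^sup>+t. f (h', t) \<partial>(Lg \<Otimes>\<^sub>M Ls \<Otimes>\<^sub>M Li \<Otimes>\<^sub>M Ln \<Otimes>\<^sub>M Lw) \<partial>Lh)"
      by (rule P4.P.nn_integral_fst[symmetric]) measurable
    also have "\<dots> = (\<integral>\<^sup>+h'. \<integral>\<^sup>+z. \<integral>\<^sup>+t. f (h', z, t) \<partial>(Ls \<Otimes>\<^sub>M Li \<Otimes>\<^sub>M Ln \<Otimes>\<^sub>M Lw) \<partial>Lg \<partial>Lh)"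
      by (intro nn_integral_cong P3.P.nn_integral_fst[symmetric]) measurable
    also have "\<dots> = (\<integral>\<^sup>+h'. \<integral>\<^sup>+z. \<integral>\<^sup>+s. \<integral>\<^sup>+t. f (h', z, s, t) \<partial>(Li \<Otimes>\<^sub>M Ln \<Otimes>\<^sub>M Lw) \<partial>Ls \<partial>Lg \<partial>Lh)"
      by (intro nn_integral_cong P2.P.nn_integral_fst[symmetric]) measurable
    also have "\<dots> = (\<integral>\<^sup>+h'. \<integral>\<^sup>+z. \<integral>\<^sup>+s. \<integral>\<^sup>+c. \<integral>\<^sup>+t. f (h', z, s, c, t) \<partial>(Ln \<Otimes>\<^sub>M Lw) \<partial>Li \<partial>Ls \<partial>Lg \<partial>Lh)"
      by (intro nn_integral_cong P1.P.nn_integral_fst[symmetric]) measurable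
    also have "\<dots> = (\<integral>\<^sup>+h'. \<integral>\<^sup>+z. \<integral>\<^sup>+s. \<integral>\<^sup>+c. \<integral>\<^sup>+n. \<integral>\<^sup>+u. f (h', z, s, c, n, u) \<partial>Lw \<partial>Ln \<partial>Li \<partial>Ls \<partial>Lg \<partial>Lh)"
      by (intro nn_integral_cong Lw.nn_integral_fst[symmetric]) measurable
    finally show ?thesis unfolding f_def .
  qed
  also have "\<dots> = (\<integral>\<^sup>+h'. \<integral>\<^sup>+z. ennreal (mean_correct_prob (pw z) ((cmod h')\<^sup>2)) \<partial>Lg \<partial>Lh)"
  proof (rule nn_integral_cong_AE)
    have "AE h' in Lh. h' \<noteq> 0" unfolding L using h_neq by (subst AE_distr_iff) auto
    then show "AE h' in Lh. (\<integral>\<^sup>+z. \<integral>\<^sup>+s. \<integral>\<^sup>+c. \<integral>\<^sup>+n. \<integral>\<^sup>+u. indicator {t. ok t} (h', z, s, c, n, u) \<partial>Lw \<partial>Ln \<partial>Li \<partial>Ls \<partial>Lg)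
       = (\<integral>\<^sup>+z. ennreal (mean_correct_prob (pw z) ((cmod h')\<^sup>2)) \<partial>Lg)"
    proof eventually_elim
      fix h' :: complex assume h': "h' \<noteq> 0"
      have "(\<integral>\<^sup>+c. \<integral>\<^sup>+n. \<integral>\<^sup>+u. indicator {t. ok t} (h', z, (j, k), c, n, u) \<partial>Lw \<partial>Ln \<partial>Li)
         = ennreal (correct_prob j (pw z) ((cmod h')\<^sup>2))" for z j k
        unfolding L nn_integral_MAP_correct[OF MAP pw_pos h', of k z j, symmetric]
        by (simp add: ok_def indicator_def add.assoc)
      then have *: "(\<integral>\<^sup>+s. \<integral>\<^sup>+c. \<integral>\<^sup>+n. \<integral>\<^sup>+u. indicator {t. ok t} (h', z, s, c, n, u) \<partial>Lw \<partial>Ln \<partial>Li \<partial>Ls)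
         = (\<integral>\<^sup>+s. ennreal (correct_prob (fst s) (pw z) ((cmod h')\<^sup>2)) \<partial>Ls)" for z
        by (intro nn_integral_cong) (metis prod.collapse)
      have "(\<integral>\<^sup>+s. ennreal (correct_prob (fst s) (pw z) ((cmod h')\<^sup>2)) \<partial>Ls)
         = ennreal (mean_correct_prob (pw z) ((cmod h')\<^sup>2))" for z
        unfolding L by (rule nn_integral_correct_prob_state[OF pw_pos]) simp
      with * show "(\<integral>\<^sup>+z. \<integral>\<^sup>+s. \<integral>\<^sup>+c. \<integral>\<^sup>+n. \<integral>\<^sup>+u. indicator {t. ok t} (h', z, s, c, n, u) \<partial>Lw \<partial>Ln \<partial>Li \<partial>Ls \<partial>Lg)
       = (\<integral>\<^sup>+z. ennreal (mean_correct_prob (pw z) ((cmod h')\<^sup>2)) \<partial>Lg)" by simp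
    qed
  qed
  \<comment> \<open>The order is exchanged so that the average over \<open>h\<close> is taken at a
    fixed power, which depends on \<open>g\<close> alone.\<close>
  also have "\<dots> = (\<integral>\<^sup>+z. \<integral>\<^sup>+h'. ennreal (mean_correct_prob (pw z) ((cmod h')\<^sup>2)) \<partial>Lh \<partial>Lg)"
    by (rule hg.Fubini'[symmetric]) measurable
  also have "\<dots> = (\<integral>\<^sup>+z. ennreal (\<integral>u. mean_correct_prob (pw z) ((cmod u)\<^sup>2) \<partial>Lh) \<partial>Lg)"
  proof (intro nn_integral_cong nn_integral_eq_integral)
    show "integrable Lh (\<lambda>u. mean_correct_prob (pw z) ((cmod u)\<^sup>2))" for z
      by (rule Lh.integrable_const_bound[where B=1]) (use mean_correct_prob_bounds[OF pw_pos] in auto)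
  qed (use mean_correct_prob_bounds[OF pw_pos] in auto)
  also have "\<dots> = ennreal (\<integral>z. \<integral>u. mean_correct_prob (pw z) ((cmod u)\<^sup>2) \<partial>Lh \<partial>Lg)"
  proof (rule nn_integral_eq_integral)
    have nn: "0 \<le> (\<integral>u. mean_correct_prob (pw z) ((cmod u)\<^sup>2) \<partial>Lh)" for z
      using mean_correct_prob_bounds[OF pw_pos] by (intro Bochner_Integration.integral_nonneg) auto
    then show "AE z in Lg. 0 \<le> (\<integral>u. mean_correct_prob (pw z) ((cmod u)\<^sup>2) \<partial>Lh)" by simp
    have "(\<integral>u. mean_correct_prob (pw z) ((cmod u)\<^sup>2) \<partial>Lh) \<le> 1" for z
      using mean_correct_prob_bounds[OF pw_pos] by (intro Lh.integral_le_const Lh.integrable_const_bound[where B=1]) auto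
    then show "integrable Lg (\<lambda>z. \<integral>u. mean_correct_prob (pw z) ((cmod u)\<^sup>2) \<partial>Lh)"
      using nn by (intro Lg.integrable_const_bound[where B=1]) auto
  qed
  finally show ?thesis
    using mean_correct_prob_bounds[OF pw_pos]
    by (simp add: L Bochner_Integration.integral_nonneg)
qed

end

subsection \<open>Averaging over Rayleigh fading\<close>

lemma integrable_exponential_density: "integrable lborel (exponential_density 1)"
  and integral_exponential_density: "(\<integral>x. exponential_density 1 x \<partial>lborel) = 1"
proof -
  have "(\<integral>\<^sup>+x. ennreal (exponential_density 1 x) \<partial>lborel) = ennreal 1"
    using prob_space.emeasure_space_1[OF prob_space_exponential_density[of 1]]
    by (simp add: emeasure_density)
  then have "has_bochner_integral lborel (exponential_density 1) 1"
    by (intro has_bochner_integral_nn_integral) (auto intro!: AE_I2 erlang_density_nonneg)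
  then show "integrable lborel (exponential_density 1)" "(\<integral>x. exponential_density 1 x \<partial>lborel) = 1"
    by (simp_all add: has_bochner_integral_iff)
qed

text \<open>The density vanishes on the negative axis, so the bound is asked for only where
  \<open>x\<close> can be a squared modulus; the bounds on the success probabilities hold only
  there.\<close>

lemma integrable_exponential_density_bounded:
  assumes [measurable]: "f \<in> borel_measurable borel" and f: "\<And>x. 0 \<le> x \<Longrightarrow> \<bar>f x\<bar> \<le> B"
  shows "integrable lborel (\<lambda>x. exponential_density 1 x * f x)"
proof (rule Bochner_Integration.integrable_bound)
  show "integrable lborel (\<lambda>x. exponential_density 1 x * B)"
    using integrable_exponential_density by simp
  have "0 \<le> B" using f[of 0] by simp
  then show "AE x in lborel. norm (exponential_density 1 x * f x) \<le> norm (exponential_density 1 x * B)"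
    using f by (intro AE_I2) (auto simp: exponential_density_def abs_mult intro!: mult_left_mono)
qed measurable

text \<open>The mean of the squared tail enters only through its integrability and sign and is not
  evaluated.\<close>

lemma integral_qam_error_prob:
  fixes MI MQ :: nat
  assumes size: "MI \<ge> 1" "MQ \<ge> 1" "MI * MQ \<ge> 2" and P: "P > 0" and v: "v > 0"
  defines "c \<equiv> 3 * P / (((real MI)\<^sup>2 + (real MQ)\<^sup>2 - 2) * v)"
    and "J \<equiv> (\<integral>x. exponential_density 1 x * (1 - qam_correct_prob MI MQ v P x) \<partial>lborel)"
  shows "J \<le> (2 - 1 / real MI - 1 / real MQ) * (1 - sqrt (c / (c + 2)))"
    and "MQ = 1 \<Longrightarrow> J = (2 - 1 / real MI - 1 / real MQ) * (1 - sqrt (c / (c + 2)))"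
proof -
  define A where "A = 2 - 1 / real MI - 1 / real MQ"
  define B where "B = 4 * (1 - 1 / real MI) * (1 - 1 / real MQ)"
  have B: "B \<ge> 0" unfolding B_def using size by (intro mult_nonneg_nonneg) auto
  have c: "c > 0" using qam_size_pos[OF size] P v by (simp add: c_def)
  have I: "has_bochner_integral lborel (\<lambda>x. exponential_density 1 x * Qfun (sqrt (c * x))) ((1 - sqrt (c / (c + 2))) / 2)"
    by (rule has_bochner_integral_exp_Qfun_sqrt[OF c])
  have "\<bar>(Qfun (sqrt (c * x)))\<^sup>2\<bar> \<le> 1" for x
    using Qfun_nonneg[of "sqrt (c * x)"] Qfun_le_1[of "sqrt (c * x)"] by (simp add: power_le_one)
  then have I2: "integrable lborel (\<lambda>x. exponential_density 1 x * (Qfun (sqrt (c * x)))\<^sup>2)"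
    by (intro integrable_exponential_density_bounded[where B=1]) measurable
  have "J = (\<integral>x. 2 * A * (exponential_density 1 x * Qfun (sqrt (c * x)))
      - B * (exponential_density 1 x * (Qfun (sqrt (c * x)))\<^sup>2) \<partial>lborel)"
    unfolding J_def qam_error_prob_eq A_def B_def c_def
    by (intro Bochner_Integration.integral_cong) (simp_all add: algebra_simps)
  also have "\<dots> = 2 * A * ((1 - sqrt (c / (c + 2))) / 2)
      - B * (\<integral>x. exponential_density 1 x * (Qfun (sqrt (c * x)))\<^sup>2 \<partial>lborel)"
    using I I2 by (subst Bochner_Integration.integral_diff) (auto simp: has_bochner_integral_iff)
  finally have J: "J = A * (1 - sqrt (c / (c + 2)))
      - B * (\<integral>x. exponential_density 1 x * (Qfun (sqrt (c * x)))\<^sup>2 \<partial>lborel)" by simp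
  have "0 \<le> (\<integral>x. exponential_density 1 x * (Qfun (sqrt (c * x)))\<^sup>2 \<partial>lborel)"
    by (intro Bochner_Integration.integral_nonneg mult_nonneg_nonneg erlang_density_nonneg) auto
  with B have "0 \<le> B * (\<integral>x. exponential_density 1 x * (Qfun (sqrt (c * x)))\<^sup>2 \<partial>lborel)"
    by (rule mult_nonneg_nonneg)
  with J show "J \<le> (2 - 1 / real MI - 1 / real MQ) * (1 - sqrt (c / (c + 2)))"
    by (simp add: A_def)
  show "J = (2 - 1 / real MI - 1 / real MQ) * (1 - sqrt (c / (c + 2)))" if "MQ = 1"
    using J that by (simp add: A_def B_def)
qed

lemma integrable_qam_error_prob:
  assumes "MI \<ge> 1" "MQ \<ge> 1" "MI * MQ \<ge> 2" "P > 0" "v > 0"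
  shows "integrable lborel (\<lambda>x. exponential_density 1 x * (1 - qam_correct_prob MI MQ v P x))"
  using qam_correct_prob_bounds[OF assms]
  by (intro integrable_exponential_density_bounded[where B=1]) auto

context sensing_channel
begin

lemma integral_cmod_rayleigh:
  fixes F :: "real \<Rightarrow> real"
  assumes "random_variable borel X"
    and "distributed M lborel (\<lambda>\<omega>. (cmod (X \<omega>))\<^sup>2) (exponential_density 1)"
    and [measurable]: "F \<in> borel_measurable borel"
  shows "(\<integral>u. F ((cmod u)\<^sup>2) \<partial>distr M borel X) = (\<integral>x. exponential_density 1 x * F x \<partial>lborel)"
proof -
  have "(\<integral>u. F ((cmod u)\<^sup>2) \<partial>distr M borel X) = (\<integral>\<omega>. F ((cmod (X \<omega>))\<^sup>2) \<partial>M)"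
    by (rule integral_distr[OF assms(1)]) measurable
  also have "\<dots> = (\<integral>x. exponential_density 1 x * F x \<partial>lborel)"
    by (rule distributed_integral[OF assms(2), symmetric]) auto
  finally show ?thesis .
qed

text \<open>A law with a density gives no mass to 0; this discharges \<open>h_neq\<close> in
  \<open>symbol_error_prob_MAP\<close>.\<close>

lemma AE_rayleigh_neq_0:
  assumes "distributed M lborel (\<lambda>\<omega>. (cmod (X \<omega>))\<^sup>2) (exponential_density 1)"
  shows "AE \<omega> in M. X \<omega> \<noteq> 0"
proof -
  have m: "(\<lambda>\<omega>. (cmod (X \<omega>))\<^sup>2) \<in> M \<rightarrow>\<^sub>M lborel"
    using assms by (simp add: distributed_def)
  have "AE x in distr M lborel (\<lambda>\<omega>. (cmod (X \<omega>))\<^sup>2). x \<noteq> 0"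
    unfolding distributed_distr_eq_density[OF assms]
    using AE_lborel_singleton[of "0::real"] by (subst AE_density) auto
  from AE_distrD[OF m this] show ?thesis by simp
qed

definition mean_error_prob :: "real \<Rightarrow> real" where
  "mean_error_prob P = (\<integral>x. exponential_density 1 x * (1 - mean_correct_prob P x) \<partial>lborel)"

lemma borel_measurable_mean_error_prob[measurable]: "mean_error_prob \<in> borel_measurable borel"
  unfolding mean_error_prob_def[abs_def] by measurable

lemma integrable_mean_error_prob:
  assumes "P > 0"
  shows "integrable lborel (\<lambda>x. exponential_density 1 x * (1 - mean_correct_prob P x))"
  using mean_correct_prob_bounds[OF assms] by (intro integrable_exponential_density_bounded[where B=1]) auto

lemma mean_error_prob_bounds:
  assumes "P > 0"
  shows "0 \<le> mean_error_prob P" "mean_error_prob P \<le> 1"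
proof -
  have *: "0 \<le> exponential_density 1 x * (1 - mean_correct_prob P x) \<and>
     exponential_density 1 x * (1 - mean_correct_prob P x) \<le> exponential_density 1 x" for x
    using mean_correct_prob_bounds[OF assms, of x] by (auto simp: exponential_density_def)
  show "0 \<le> mean_error_prob P"
    unfolding mean_error_prob_def using * by (intro Bochner_Integration.integral_nonneg) auto
  have "mean_error_prob P \<le> (\<integral>x. exponential_density 1 x \<partial>lborel)"
    unfolding mean_error_prob_def using *
    by (intro integral_mono integrable_mean_error_prob[OF assms] integrable_exponential_density) auto
  then show "mean_error_prob P \<le> 1" by (simp add: integral_exponential_density)
qed

text \<open>The power depends on \<open>g\<close> only through its squared modulus, so both fading
  averages become integrals against the exponential density. A constant \<open>pw\<close> gives the
  fixed-power error probability, the peak-limited one gives \<open>SEP\<close>.\<close>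

lemma symbol_error_prob_rayleigh:
  assumes MAP: "is_MAP_detector M H Hhat fn fw MI MQ \<delta>"
    and [measurable]: "pw \<in> borel_measurable borel" and pos: "\<And>y. pw y > 0"
    and rayleigh_h: "distributed M lborel (\<lambda>\<omega>. (cmod (h \<omega>))\<^sup>2) (exponential_density 1)"
    and rayleigh_g: "distributed M lborel (\<lambda>\<omega>. (cmod (g \<omega>))\<^sup>2) (exponential_density 1)"
  shows "symbol_error_prob M H Hhat idx h g noise w MI MQ (\<lambda>k z. pw ((cmod z)\<^sup>2)) \<delta>
    = (\<integral>y. exponential_density 1 y * mean_error_prob (pw y) \<partial>lborel)"
proof -
  have R: "mean_error_prob (pw y) = 1 - (\<integral>u. mean_correct_prob (pw y) ((cmod u)\<^sup>2) \<partial>distr M borel h)" for y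
  proof -
    have "integrable lborel (\<lambda>x. exponential_density 1 x * mean_correct_prob (pw y) x)"
      using mean_correct_prob_bounds[OF pos[of y]] by (intro integrable_exponential_density_bounded[where B=1]) auto
    then show ?thesis
      unfolding mean_error_prob_def
      by (subst integral_cmod_rayleigh[OF measurable_fading(1) rayleigh_h])
         (auto simp: right_diff_distrib integrable_exponential_density integral_exponential_density)
  qed
  have "symbol_error_prob M H Hhat idx h g noise w MI MQ (\<lambda>k z. pw ((cmod z)\<^sup>2)) \<delta>
    = 1 - (\<integral>z. 1 - mean_error_prob (pw ((cmod z)\<^sup>2)) \<partial>distr M borel g)"
    by (subst symbol_error_prob_MAP[OF MAP _ pos AE_rayleigh_neq_0[OF rayleigh_h]]) (simp_all add: R)
  also have "(\<integral>z. 1 - mean_error_prob (pw ((cmod z)\<^sup>2)) \<partial>distr M borel g)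
    = (\<integral>y. exponential_density 1 y * (1 - mean_error_prob (pw y)) \<partial>lborel)"
    by (rule integral_cmod_rayleigh[OF measurable_fading(2) rayleigh_g, of "\<lambda>y. 1 - mean_error_prob (pw y)"]) measurable
  also have "\<dots> = 1 - (\<integral>y. exponential_density 1 y * mean_error_prob (pw y) \<partial>lborel)"
  proof -
    have "integrable lborel (\<lambda>y. exponential_density 1 y * mean_error_prob (pw y))"
      using mean_error_prob_bounds[OF pos] by (intro integrable_exponential_density_bounded[where B=1]) auto
    then show ?thesis
      by (simp add: right_diff_distrib integrable_exponential_density integral_exponential_density)
  qed
  finally show ?thesis by simp
qed

section \<open>Fixed-power bound, total probability, and the average over the peak-limited
  power\<close>

text \<open>Both the state probabilities and the mixture weights sum to 1, so the error probability
  is the same convex combination of component errors as the success probability is of component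
  successes.\<close>

lemma mean_error_prob_bound:
  fixes V :: "real \<Rightarrow> real"
  assumes P: "P > 0"
    and V: "\<And>v. V v = (let c = 3 * P / (((real MI)\<^sup>2 + (real MQ)\<^sup>2 - 2) * v) in 1 - sqrt (c / (c + 2)))"
  defines "B \<equiv> (2 - 1 / real MI - 1 / real MQ) *
      (\<P>(\<omega> in M. \<not> H \<omega>) * V (\<sigma>n\<^sup>2) + \<P>(\<omega> in M. H \<omega>) * (\<Sum>l=1..p. lam l * V ((\<sigma> l)\<^sup>2 + \<sigma>n\<^sup>2)))"
  shows "mean_error_prob P \<le> B" "MQ = 1 \<Longrightarrow> mean_error_prob P = B"
proof -
  define J where "J v = (\<integral>x. exponential_density 1 x * (1 - qam_correct_prob MI MQ v P x) \<partial>lborel)" for v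
  let ?C = "2 - 1 / real MI - 1 / real MQ"
  have J: "has_bochner_integral lborel (\<lambda>x. exponential_density 1 x * (1 - qam_correct_prob MI MQ v P x)) (J v)"
    if "v > 0" for v
    unfolding J_def by (rule has_bochner_integral_integrable[OF integrable_qam_error_prob[OF size P that]])
  have le: "J v \<le> ?C * V v" and eq: "MQ = 1 \<Longrightarrow> J v = ?C * V v" if "v > 0" for v
    using integral_qam_error_prob[OF size P that] by (simp_all add: J_def V Let_def)
  have "1 - mean_correct_prob P x = \<P>(\<omega> in M. \<not> H \<omega>) * (1 - qam_correct_prob MI MQ (\<sigma>n\<^sup>2) P x)
      + \<P>(\<omega> in M. H \<omega>) * (\<Sum>l=1..p. lam l * (1 - qam_correct_prob MI MQ ((\<sigma> l)\<^sup>2 + \<sigma>n\<^sup>2) P x))" for x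
    unfolding right_diff_distrib sum_subtractf
    by (simp add: mean_correct_prob_def correct_prob_def weight_sum[simplified] prob_not_H algebra_simps)
  then have "mean_error_prob P = (\<integral>x.
      \<P>(\<omega> in M. \<not> H \<omega>) * (exponential_density 1 x * (1 - qam_correct_prob MI MQ (\<sigma>n\<^sup>2) P x))
      + \<P>(\<omega> in M. H \<omega>) * (\<Sum>l=1..p. lam l * (exponential_density 1 x * (1 - qam_correct_prob MI MQ ((\<sigma> l)\<^sup>2 + \<sigma>n\<^sup>2) P x))) \<partial>lborel)"
    unfolding mean_error_prob_def
    by (intro Bochner_Integration.integral_cong refl) (simp only: distrib_left sum_distrib_left mult.left_commute)
  also have "\<dots> = \<P>(\<omega> in M. \<not> H \<omega>) * J (\<sigma>n\<^sup>2) + \<P>(\<omega> in M. H \<omega>) * (\<Sum>l=1..p. lam l * J ((\<sigma> l)\<^sup>2 + \<sigma>n\<^sup>2))"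
    by (intro has_bochner_integral_integral_eq has_bochner_integral_add has_bochner_integral_mult_right
        has_bochner_integral_sum J noise_var_pos component_var_pos)
  finally have *: "mean_error_prob P = \<dots>" .
  have B: "B = \<P>(\<omega> in M. \<not> H \<omega>) * (?C * V (\<sigma>n\<^sup>2)) + \<P>(\<omega> in M. H \<omega>) * (\<Sum>l=1..p. lam l * (?C * V ((\<sigma> l)\<^sup>2 + \<sigma>n\<^sup>2)))"
    unfolding B_def by (simp only: distrib_left sum_distrib_left mult.left_commute)
  show "mean_error_prob P \<le> B"
    unfolding * B
    by (intro add_mono mult_left_mono sum_mono le measure_nonneg weight_nonneg noise_var_pos component_var_pos)
  show "mean_error_prob P = B" if "MQ = 1"
    unfolding * B using eq[OF _ that] noise_var_pos component_var_pos by simp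
qed

text \<open>Multiplying by the probability of the decision turns each conditional probability into a
  joint one, and summing over decisions gives the prior. It applies because \<open>x\<close> and
  \<open>y\<close> do not vary with \<open>k\<close>.\<close>

lemma sum_decision_cond_prob:
  fixes x y :: real
  shows "(\<Sum>k\<in>{False, True}. \<P>(\<omega> in M. Hhat \<omega> = k) *
      (\<P>(\<omega> in M. \<not> H \<omega> \<bar> Hhat \<omega> = k) * x + \<P>(\<omega> in M. H \<omega> \<bar> Hhat \<omega> = k) * y))
    = \<P>(\<omega> in M. \<not> H \<omega>) * x + \<P>(\<omega> in M. H \<omega>) * y"
proof -
  note [measurable] = measurable_state
  have split: "\<P>(\<omega> in M. X \<omega> \<and> Hhat \<omega> = False) + \<P>(\<omega> in M. X \<omega> \<and> Hhat \<omega> = True) = \<P>(\<omega> in M. X \<omega>)"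
    if [measurable]: "Measurable.pred M X" for X
  proof -
    have "\<P>(\<omega> in M. X \<omega> \<and> Hhat \<omega> = False) + \<P>(\<omega> in M. X \<omega> \<and> Hhat \<omega> = True)
      = prob ({\<omega> \<in> space M. X \<omega> \<and> Hhat \<omega> = False} \<union> {\<omega> \<in> space M. X \<omega> \<and> Hhat \<omega> = True})"
      by (rule finite_measure_Union[symmetric]) auto
    also have "{\<omega> \<in> space M. X \<omega> \<and> Hhat \<omega> = False} \<union> {\<omega> \<in> space M. X \<omega> \<and> Hhat \<omega> = True} = {\<omega> \<in> space M. X \<omega>}"
      by auto
    finally show ?thesis .
  qed
  have cancel: "\<P>(\<omega> in M. Hhat \<omega> = k) * (a / \<P>(\<omega> in M. Hhat \<omega> = k) * x + b / \<P>(\<omega> in M. Hhat \<omega> = k) * y) = a * x + b * y"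
    for k a b
    using decision_pos[of k] by (simp add: distrib_left)
  show ?thesis
    unfolding cond_prob_def cancel by (simp add: split[of "\<lambda>\<omega>. \<not> H \<omega>", symmetric] split[of H, symmetric] distrib_right)
qed


lemma symbol_error_prob_peak_limited:
  assumes MAP: "is_MAP_detector M H Hhat fn fw MI MQ \<delta>"
    and rayleigh_h: "distributed M lborel (\<lambda>\<omega>. (cmod (h \<omega>))\<^sup>2) (exponential_density 1)"
    and rayleigh_g: "distributed M lborel (\<lambda>\<omega>. (cmod (g \<omega>))\<^sup>2) (exponential_density 1)"
    and pos: "Ppk > 0" "Qpk > 0"
  defines "b \<equiv> Qpk / Ppk"
  shows "symbol_error_prob M H Hhat idx h g noise w MI MQ (\<lambda>k. peak_limited_power Ppk Qpk) \<delta>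
     = (1 - exp (- b)) * mean_error_prob Ppk
       + (\<integral>y. indicator {b<..} y * (exp (- y) * mean_error_prob (Qpk / y)) \<partial>lborel)"
    and "integrable lborel (\<lambda>y. indicator {b<..} y * (exp (- y) * mean_error_prob (Qpk / y)))"
proof -
  let ?R = mean_error_prob
  \<comment> \<open>The value \<open>Ppk\<close> at 0 agrees with \<open>peak_limited_power\<close>;
    extending it to negative arguments keeps \<open>pw\<close> positive everywhere, as
    \<open>symbol_error_prob_rayleigh\<close> requires.\<close>
  define pw where "pw y = (if y \<le> 0 then Ppk else min Ppk (Qpk / y))" for y
  have pw_pos: "pw y > 0" for y using pos by (simp add: pw_def)
  have [measurable]: "pw \<in> borel_measurable borel" unfolding pw_def[abs_def] by measurable
  have b: "b > 0" using pos by (simp add: b_def)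
  have pw_tail: "pw y = Qpk / y" if "b < y" for y
  proof -
    have "y > 0" using that b by simp
    moreover from this have "Qpk / y \<le> Ppk" using that pos by (simp add: b_def field_simps)
    ultimately show ?thesis by (simp add: pw_def)
  qed
  have tail: "has_bochner_integral lborel (\<lambda>y. indicator {b<..} y * exp (- y)) (0 - (- exp (- b)))"
  proof (rule has_bochner_integral_FTC_at_top)
    show "((\<lambda>x. - exp (- x)) \<longlongrightarrow> - exp (- b)) (at_right b)"
      by (intro tendsto_intros)
    show "((\<lambda>x::real. - exp (- x)) \<longlongrightarrow> 0) at_top"
      using tendsto_minus[OF exp_minus_tendsto_0] by simp
  qed (auto intro!: derivative_eq_intros continuous_intros)
  have "integrable lborel (\<lambda>y. exponential_density 1 y * (indicator {b<..} y * ?R (pw y)))"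
    using mean_error_prob_bounds[OF pw_pos]
    by (intro integrable_exponential_density_bounded[where B=1]) (auto simp: indicator_def)
  moreover have "exponential_density 1 y * (indicator {b<..} y * ?R (pw y))
      = indicator {b<..} y * (exp (- y) * ?R (Qpk / y))" for y
  proof (cases "b < y")
    case True
    then have "pw y = Qpk / y" by (rule pw_tail)
    then show ?thesis using True b by (simp add: exponential_density_def)
  qed simp
  ultimately show int: "integrable lborel (\<lambda>y. indicator {b<..} y * (exp (- y) * ?R (Qpk / y)))" by simp
  \<comment> \<open>The two limits coincide at \<open>y = b\<close>. The part at constant power is
    written as the full mean minus its tail, which integrates to the factor
    \<open>1 - exp (- b)\<close>.\<close>
  have dec: "exponential_density 1 y * ?R (pw y) = exponential_density 1 y * ?R Ppk
     - indicator {b<..} y * exp (- y) * ?R Ppk + indicator {b<..} y * (exp (- y) * ?R (Qpk / y))" for y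
  proof (cases "b < y")
    case True
    then have "pw y = Qpk / y" by (rule pw_tail)
    then show ?thesis using True b by (simp add: exponential_density_def)
  next
    case False
    then have "0 \<le> y \<Longrightarrow> pw y = Ppk" using pos by (auto simp: pw_def b_def field_simps min_def)
    then show ?thesis using False by (auto simp: exponential_density_def)
  qed
  have "peak_limited_power Ppk Qpk z = pw ((cmod z)\<^sup>2)" for z
    by (auto simp: peak_limited_power_def pw_def)
  then have "symbol_error_prob M H Hhat idx h g noise w MI MQ (\<lambda>k. peak_limited_power Ppk Qpk) \<delta>
      = symbol_error_prob M H Hhat idx h g noise w MI MQ (\<lambda>k z. pw ((cmod z)\<^sup>2)) \<delta>"
    by presburger
  also have "\<dots> = (\<integral>y. exponential_density 1 y * ?R (pw y) \<partial>lborel)"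
    by (rule symbol_error_prob_rayleigh[OF MAP _ pw_pos rayleigh_h rayleigh_g]) measurable
  also have "\<dots> = (1 - exp (- b)) * ?R Ppk + (\<integral>y. indicator {b<..} y * (exp (- y) * ?R (Qpk / y)) \<partial>lborel)"
    unfolding dec using tail int
    by (subst Bochner_Integration.integral_add Bochner_Integration.integral_diff)+
       (auto simp: has_bochner_integral_iff integrable_exponential_density integral_exponential_density left_diff_distrib)
  finally show "symbol_error_prob M H Hhat idx h g noise w MI MQ (\<lambda>k. peak_limited_power Ppk Qpk) \<delta>
     = (1 - exp (- b)) * ?R Ppk + (\<integral>y. indicator {b<..} y * (exp (- y) * ?R (Qpk / y)) \<partial>lborel)" .
qed

text \<open>At power \<open>Qpk / y\<close> the constant \<open>c\<close> of a component with
  variance \<open>v\<close> equals \<open>2 * G v / y\<close>, which puts the fixed-power bound in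
  the form integrated by \<open>has_bochner_integral_exp_tail\<close>.\<close>

lemma integral_tail_mean_error_prob:
  assumes Q: "Qpk > 0" and b: "b > 0"
    and int: "integrable lborel (\<lambda>y. indicator {b<..} y * (exp (- y) * mean_error_prob (Qpk / y)))"
  defines "G v \<equiv> 3 * Qpk / (2 * ((real MI)\<^sup>2 + (real MQ)\<^sup>2 - 2) * v)"
  defines "T v \<equiv> exp (- b) - 2 * sqrt (G v * pi) * exp (G v) * Qfun (sqrt (2 * (b + G v)))"
  defines "B \<equiv> (2 - 1 / real MI - 1 / real MQ) *
      (\<P>(\<omega> in M. \<not> H \<omega>) * T (\<sigma>n\<^sup>2) + \<P>(\<omega> in M. H \<omega>) * (\<Sum>l=1..p. lam l * T ((\<sigma> l)\<^sup>2 + \<sigma>n\<^sup>2)))"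
  shows "(\<integral>y. indicator {b<..} y * (exp (- y) * mean_error_prob (Qpk / y)) \<partial>lborel) \<le> B"
    and "MQ = 1 \<Longrightarrow> (\<integral>y. indicator {b<..} y * (exp (- y) * mean_error_prob (Qpk / y)) \<partial>lborel) = B"
proof -
  define D where "D = (real MI)\<^sup>2 + (real MQ)\<^sup>2 - 2"
  have D: "D > 0" using qam_size_pos[OF size] by (simp add: D_def)
  define V where "V P v = (let c = 3 * P / (D * v) in 1 - sqrt (c / (c + 2)))" for P v
  define E where "E P = (2 - 1 / real MI - 1 / real MQ) *
      (\<P>(\<omega> in M. \<not> H \<omega>) * V P (\<sigma>n\<^sup>2) + \<P>(\<omega> in M. H \<omega>) * (\<Sum>l=1..p. lam l * V P ((\<sigma> l)\<^sup>2 + \<sigma>n\<^sup>2)))" for P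
  have bound: "mean_error_prob P \<le> E P" "MQ = 1 \<Longrightarrow> mean_error_prob P = E P" if "P > 0" for P
    unfolding E_def by (rule mean_error_prob_bound[OF that]; simp add: V_def D_def)+
  have V: "V (Qpk / y) v = 1 - sqrt (G v / (y + G v))" if "y > 0" "v > 0" for y v
  proof -
    have "G v > 0" using that Q D by (simp add: G_def D_def[symmetric])
    moreover have "3 * (Qpk / y) / (D * v) = 2 * G v / y" by (simp add: G_def D_def[symmetric])
    moreover have "2 * a / y / (2 * a / y + 2) = a / (y + a)" if "a > 0" for a
      using that \<open>y > 0\<close> by (simp add: field_simps)
    ultimately show ?thesis by (simp only: V_def Let_def)
  qed
  have T: "has_bochner_integral lborel (\<lambda>y. indicator {b<..} y * (exp (- y) * V (Qpk / y) v)) (T v)" if v: "v > 0" for v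
  proof -
    have "G v > 0" using v Q D by (simp add: G_def D_def[symmetric])
    from has_bochner_integral_exp_tail[OF this less_imp_le[OF b]]
    show ?thesis unfolding T_def
      by (rule has_bochner_integral_cong[THEN iffD1, rotated -1]) (use V[OF _ v] b in \<open>auto simp: indicator_def\<close>)
  qed
  have "has_bochner_integral lborel (\<lambda>y. (2 - 1 / real MI - 1 / real MQ) *
      (\<P>(\<omega> in M. \<not> H \<omega>) * (indicator {b<..} y * (exp (- y) * V (Qpk / y) (\<sigma>n\<^sup>2)))
      + \<P>(\<omega> in M. H \<omega>) * (\<Sum>l=1..p. lam l * (indicator {b<..} y * (exp (- y) * V (Qpk / y) ((\<sigma> l)\<^sup>2 + \<sigma>n\<^sup>2)))))) B"
    unfolding B_def
    by (intro has_bochner_integral_mult_right has_bochner_integral_add has_bochner_integral_sum T noise_var_pos component_var_pos)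
  then have EB: "has_bochner_integral lborel (\<lambda>y. indicator {b<..} y * (exp (- y) * E (Qpk / y))) B"
    by (simp only: E_def distrib_left sum_distrib_left mult.left_commute)
  \<comment> \<open>The fixed-power bound applies pointwise, since \<open>y > b > 0\<close> makes
    the power \<open>Qpk / y\<close> positive.\<close>
  have "(\<integral>y. indicator {b<..} y * (exp (- y) * mean_error_prob (Qpk / y)) \<partial>lborel)
      \<le> (\<integral>y. indicator {b<..} y * (exp (- y) * E (Qpk / y)) \<partial>lborel)"
    using EB int bound(1) Q b
    by (intro integral_mono) (auto simp: has_bochner_integral_iff indicator_def)
  then show "(\<integral>y. indicator {b<..} y * (exp (- y) * mean_error_prob (Qpk / y)) \<partial>lborel) \<le> B"
    using EB by (simp add: has_bochner_integral_iff)
  show "(\<integral>y. indicator {b<..} y * (exp (- y) * mean_error_prob (Qpk / y)) \<partial>lborel) = B" if "MQ = 1"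
  proof -
    have "indicator {b<..} y * (exp (- y) * mean_error_prob (Qpk / y)) = indicator {b<..} y * (exp (- y) * E (Qpk / y))" for y
      using bound(2)[of "Qpk / y"] that Q b by (simp add: indicator_def)
    then show ?thesis using EB by (simp only: has_bochner_integral_iff)
  qed
qed

end

theorem mainTheorem5:
  fixes M :: "'w measure"
    and H Hhat :: "'w \<Rightarrow> bool"
    and idx :: "'w \<Rightarrow> nat \<times> nat"
    and h g noise w :: "'w \<Rightarrow> complex"
    and MI MQ p :: nat
    and lam \<sigma> :: "nat \<Rightarrow> real"
    and \<sigma>n Ppk Qpk b1 \<gamma>0 :: real
    and \<gamma>1 :: "nat \<Rightarrow> real"
    and \<delta> \<delta>pk :: "bool \<Rightarrow> real \<Rightarrow> complex \<Rightarrow> complex \<Rightarrow> complex"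
    and SEP SEPpk :: real
  assumes channel: "sensing_channel M H Hhat idx h g noise w MI MQ p lam \<sigma> \<sigma>n"
    and rayleigh_h: "distributed M lborel (\<lambda>\<omega>. (cmod (h \<omega>))\<^sup>2) (exponential_density 1)"
    and rayleigh_g: "distributed M lborel (\<lambda>\<omega>. (cmod (g \<omega>))\<^sup>2) (exponential_density 1)"
    and limits_pos: "Ppk > 0" "Qpk > 0"
    and MAP: "is_MAP_detector M H Hhat (cgauss_density (\<sigma>n\<^sup>2))
                (gauss_mixture_density p lam \<sigma>) MI MQ \<delta>"
    and MAP_pk: "is_MAP_detector M H Hhat (cgauss_density (\<sigma>n\<^sup>2))
                (gauss_mixture_density p lam \<sigma>) MI MQ \<delta>pk"
    and SEP: "SEP = symbol_error_prob M H Hhat idx h g noise w MI MQ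
                (\<lambda>k. peak_limited_power Ppk Qpk) \<delta>"
    and SEPpk: "SEPpk = symbol_error_prob M H Hhat idx h g noise w MI MQ
                (\<lambda>k z. Ppk) \<delta>pk"
    and b1: "b1 = Qpk / Ppk"
    and \<gamma>0: "\<gamma>0 = 3 * b1 * Ppk / (2 * ((real MI)\<^sup>2 + (real MQ)\<^sup>2 - 2) * \<sigma>n\<^sup>2)"
    and \<gamma>1: "\<And>l. \<gamma>1 l = 3 * b1 * Ppk
                / (2 * ((real MI)\<^sup>2 + (real MQ)\<^sup>2 - 2) * ((\<sigma> l)\<^sup>2 + \<sigma>n\<^sup>2))"
  shows "let B = (1 - exp (- b1)) * SEPpk
               + (2 - 1 / real MI - 1 / real MQ) *
                 (\<Sum>k\<in>{False, True}. \<P>(\<omega> in M. Hhat \<omega> = k) *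
                   (\<P>(\<omega> in M. \<not> H \<omega> \<bar> Hhat \<omega> = k) *
                      (exp (- b1) - 2 * sqrt (\<gamma>0 * pi) * exp \<gamma>0 * Qfun (sqrt (2 * (b1 + \<gamma>0))))
                  + \<P>(\<omega> in M. H \<omega> \<bar> Hhat \<omega> = k) *
                      (\<Sum>l=1..p. lam l *
                        (exp (- b1) - 2 * sqrt (\<gamma>1 l * pi) * exp (\<gamma>1 l)
                                      * Qfun (sqrt (2 * (b1 + \<gamma>1 l)))))))
         in SEP \<le> B \<and> (MQ = 1 \<longrightarrow> SEP = B)"
proof -
  interpret sensing_channel M H Hhat idx h g noise w MI MQ p lam \<sigma> \<sigma>n by (fact channel)
  have b: "b1 > 0" and Q: "b1 * Ppk = Qpk" using limits_pos by (simp_all add: b1)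
  \<comment> \<open>The detectors \<open>\<delta>\<close> and \<open>\<delta>pk\<close> may break
    ties differently; either error probability depends on its detector only through the MAP
    property, so both are expressed by \<open>mean_error_prob\<close>. At constant power the average
    over \<open>g\<close> is trivial.\<close>
  have pk: "SEPpk = mean_error_prob Ppk"
    using symbol_error_prob_rayleigh[OF MAP_pk _ limits_pos(1) rayleigh_h rayleigh_g]
    by (simp add: SEPpk integral_exponential_density)
  have pl: "SEP = (1 - exp (- b1)) * SEPpk + (\<integral>y. indicator {b1<..} y * (exp (- y) * mean_error_prob (Qpk / y)) \<partial>lborel)"
    and int: "integrable lborel (\<lambda>y. indicator {b1<..} y * (exp (- y) * mean_error_prob (Qpk / y)))"
    unfolding SEP pk b1 using symbol_error_prob_peak_limited[OF MAP rayleigh_h rayleigh_g limits_pos] by simp_all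
  have \<gamma>: "\<gamma>0 = 3 * Qpk / (2 * ((real MI)\<^sup>2 + (real MQ)\<^sup>2 - 2) * \<sigma>n\<^sup>2)"
    "\<gamma>1 l = 3 * Qpk / (2 * ((real MI)\<^sup>2 + (real MQ)\<^sup>2 - 2) * ((\<sigma> l)\<^sup>2 + \<sigma>n\<^sup>2))" for l
    unfolding \<gamma>0 \<gamma>1 mult.assoc[of 3] Q by (rule refl)+
  show ?thesis
    unfolding Let_def sum_decision_cond_prob \<gamma> pl
    using integral_tail_mean_error_prob[OF limits_pos(2) b int] by simp
qed

end
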